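(* Let $q$ be real-valued, integrable and compactly supported. Let $r>0$ and $r_1=r+\frac12$. (Case 1, the line.) Let $q$ be defined on $\mathbb R$ with $\operatorname{supp} q\subset[0,\gamma]$ but in no smaller interval. Then $$\mathcal N(r,w)\le \frac1{\log 2}\left(\frac{4r_1\gamma}{\pi}+\log(1+4r_1)+\frac{9Q}{1+4r_1}\right),$$ where $w$ is the Wronskian of the Jost solutions and $Q=\max\{\|q\|,\|q\|_1\}$. (Cases 2 and 3, the half-line.) Let $q$ be defined on $\mathbb R_+=[0,\infty)$ and let $\gamma=\sup(\operatorname{supp} q)$. Then $$\frac{\mathcal N(r,\psi_+(0,\cdot))+\mathcal N(r,\psi_+'(0,\cdot))}{2}\le \frac1{\log 2}\left(\frac{4r_1\gamma}{\pi}+\log(1+4r_1)+\frac{9\|q\|\max\{1,\gamma\}}{1+4r_1}\right).$$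
   Context: Consider the Schrödinger operator $H=H_0+q$, where $H_0=-d^2/dx^2$ acts: in $L^2(\mathbb R)$ (Case 1); in $L^2(\mathbb R_+)$ with the boundary condition $f(0)=0$ (Case 2); in $L^2(\mathbb R_+)$ with the boundary condition $f'(0)=0$ (Case 3). For $k\in\mathbb C\setminus\{0\}$ the equation $-f''+q(x)f=k^2f$ has unique solutions $\psi_\pm(x,k)$ such that $\psi_+(x,k)=e^{ikx}$ for large positive $x$ and (Case 1) $\psi_-(x,k)=e^{-ikx}$ for large negative $x$. For each $x$ the functions $\psi_\pm(x,\cdot)$, $\psi_\pm'(x,\cdot)$ (with $'=d/dx$) are (extend to) entire functions of $k$. In Case 1 set $w(k)=\{\psi_-(\cdot,k),\psi_+(\cdot,k)\}$, where $\{f,g\}=fg'-f'g$; in Case 2 the Jost function is $\psi_+(0,\cdot)$; in Case 3 it is $\psi_+'(0,\cdot)$. All these are entire functions of $k$. $\mathcal N(r,f)$ denotes the number of zeros of $f$ of modulus $\le r$, each counted according to its multiplicity. $\|q\|=\int|q(t)|\,dt$ and $\|q\|_1=\int|t\,q(t)|\,dt$, the integrals being over $\mathbb R$ (where $q$ on the half-line is extended by zero). *)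

theory Defs
  imports "HOL-Complex_Analysis.Complex_Analysis"
begin

text \<open>Essential support on \<open>I\<close> (\<open>I = UNIV\<close> or \<open>I = {0..}\<close>): a potential is an element of
  \<open>L\<^sup>1(I)\<close>, so null sets are ignored.\<close>

definition ess_support :: "real set \<Rightarrow> (real \<Rightarrow> real) \<Rightarrow> real set" where
  "ess_support I q =
     {x \<in> I. \<forall>e>0. \<not> negligible {t \<in> I \<inter> ball x e. q t \<noteq> 0}}"

text \<open>Caratheodory solution of \<open>-f'' + q f = k\<^sup>2 f\<close> on \<open>I\<close>: since \<open>q\<close> is merely integrable,
  \<open>f\<close> is \<open>C\<^sup>1\<close> (one-sided derivative at an endpoint of \<open>I\<close>) and \<open>f' = g\<close> is an indefinite
  integral of \<open>(q - k\<^sup>2) f\<close>.\<close>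

definition schroedinger_solution ::
    "real set \<Rightarrow> (real \<Rightarrow> real) \<Rightarrow> complex \<Rightarrow> (real \<Rightarrow> complex) \<Rightarrow> bool" where
  "schroedinger_solution I q k f \<longleftrightarrow>
     (\<exists>g. (\<forall>x\<in>I. (f has_vector_derivative g x) (at x within I)) \<and>
          (\<forall>a\<in>I. \<forall>b\<in>I. a \<le> b \<longrightarrow>
             ((\<lambda>t. (complex_of_real (q t) - k\<^sup>2) * f t) has_integral (g b - g a)) {a..b}))"

text \<open>The choice operator picks the unique solution with the prescribed behaviour; uniqueness is
  on \<open>I\<close>, values outside \<open>I\<close> are irrelevant.\<close>

definition jost_plus_solution :: "real set \<Rightarrow> (real \<Rightarrow> real) \<Rightarrow> complex \<Rightarrow> real \<Rightarrow> complex" where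
  "jost_plus_solution I q k =
     (SOME f. schroedinger_solution I q k f \<and>
              (\<forall>\<^sub>F x in at_top. f x = exp (\<i> * k * complex_of_real x)))"

definition jost_minus_solution :: "(real \<Rightarrow> real) \<Rightarrow> complex \<Rightarrow> real \<Rightarrow> complex" where
  "jost_minus_solution q k =
     (SOME f. schroedinger_solution UNIV q k f \<and>
              (\<forall>\<^sub>F x in at_bot. f x = exp (- \<i> * k * complex_of_real x)))"

text \<open>\<open>\<psi>\<^sub>+(x,k)\<close> and \<open>\<psi>\<^sub>-(x,k)\<close>; the value at \<open>k = 0\<close> is that of the entire extension.\<close>

definition jost_plus :: "real set \<Rightarrow> (real \<Rightarrow> real) \<Rightarrow> real \<Rightarrow> complex \<Rightarrow> complex" where
  "jost_plus I q x k =
     (if k = 0 then Lim (at 0) (\<lambda>k. jost_plus_solution I q k x) else jost_plus_solution I q k x)"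

definition jost_minus :: "(real \<Rightarrow> real) \<Rightarrow> real \<Rightarrow> complex \<Rightarrow> complex" where
  "jost_minus q x k =
     (if k = 0 then Lim (at 0) (\<lambda>k. jost_minus_solution q k x) else jost_minus_solution q k x)"

definition jost_plus_deriv :: "real set \<Rightarrow> (real \<Rightarrow> real) \<Rightarrow> real \<Rightarrow> complex \<Rightarrow> complex" where
  "jost_plus_deriv I q x k = vector_derivative (\<lambda>y. jost_plus I q y k) (at x within I)"

definition jost_minus_deriv :: "(real \<Rightarrow> real) \<Rightarrow> real \<Rightarrow> complex \<Rightarrow> complex" where
  "jost_minus_deriv q x k = vector_derivative (\<lambda>y. jost_minus q y k) (at x)"

text \<open>The Wronskian \<open>\<psi>\<^sub>- \<psi>\<^sub>+' - \<psi>\<^sub>-' \<psi>\<^sub>+\<close> evaluated at \<open>x\<close>; it does not depend on \<open>x\<close>.\<close>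

definition jost_wronskian :: "(real \<Rightarrow> real) \<Rightarrow> real \<Rightarrow> complex \<Rightarrow> complex" where
  "jost_wronskian q x k =
     jost_minus q x k * jost_plus_deriv UNIV q x k - jost_minus_deriv q x k * jost_plus UNIV q x k"

text \<open>Zeros of modulus at most \<open>r\<close>, counted with multiplicity. The value \<open>\<infinity>\<close> prevents an
  infinite zero set from being counted as \<open>0\<close>.\<close>

definition zero_count :: "real \<Rightarrow> (complex \<Rightarrow> complex) \<Rightarrow> ereal" where
  "zero_count r f =
     (let Z = {z. cmod z \<le> r \<and> f z = 0}
      in if finite Z then ereal (\<Sum>z\<in>Z. real_of_int (zorder f z)) else \<infinity>)"

end

theory Submission
  imports Defs
begin

text \<open>
  Every zero count is an application of Jensen's formula to an entire function of \<open>k\<close>, on discs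
  centred at the real point \<open>1/2\<close>. The disc \<open>\<bar>k\<bar> \<le> r\<close> lies in the disc of radius \<open>r\<^sub>1 = r + 1/2\<close> about
  \<open>1/2\<close>, so comparison with the circle of radius \<open>2r\<^sub>1\<close> gives each zero a weight of at least \<open>ln 2\<close>. Two
  facts about the entire functions are needed.

  \<^item> \<^emph>\<open>Upper bound.\<close> Writing \<open>\<psi>\<^sub>+ = A e\<^sup>i\<^sup>k\<^sup>x + B e\<^sup>-\<^sup>i\<^sup>k\<^sup>x\<close> with varying amplitudes and applying Gronwall's
    inequality to a suitably weighted sum of \<open>\<bar>A\<bar>\<close> and \<open>\<bar>B\<bar>\<close> gives
    \<open>\<bar>\<psi>\<^sub>+(0,k)\<bar> \<le> exp (2\<gamma> (Im k)\<^sub>- + \<parallel>q\<parallel>/\<bar>k\<bar>)\<close>, where \<open>(Im k)\<^sub>- = max 0 (- Im k)\<close>, and the same bound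
    times \<open>\<bar>k\<bar>\<close> for \<open>\<psi>\<^sub>+'(0,k)\<close> (\<open>solves_on_modulus_bound\<close>). The mean of \<open>2\<gamma> (Im k)\<^sub>-\<close> over the circle
    of radius \<open>2r\<^sub>1\<close> is \<open>4r\<^sub>1\<gamma>/\<pi>\<close>, and there \<open>1/\<bar>k\<bar> \<le> 9/(1 + 4r\<^sub>1)\<close>.
  \<^item> \<^emph>\<open>Lower bound at the centre.\<close> For real \<open>q\<close> and real \<open>k\<close> the flux \<open>Im (cnj \<psi>\<^sub>+ \<psi>\<^sub>+')\<close> does not depend
    on \<open>x\<close>, hence equals \<open>k\<close> (\<open>solves_on_flux\<close>). It follows that \<open>\<bar>\<psi>\<^sub>+(0,k) \<psi>\<^sub>+'(0,k)\<bar> \<ge> k\<close> and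
    \<open>\<bar>w(k)\<bar> \<ge> 2k\<close> for \<open>k > 0\<close>. This is why the centre is real: at a point such as \<open>\<i>/2\<close> the function may
    vanish, namely when \<open>-1/4\<close> is an eigenvalue. On the half-line only the product is controlled,
    so there the two zero counts are estimated together.

  On the line \<open>\<psi>\<^sub>-(x,k) = e\<^sup>-\<^sup>i\<^sup>k\<^sup>x\<close> for \<open>x \<le> 0\<close>, so \<open>w(k) = \<psi>\<^sub>+'(0,k) + ik \<psi>\<^sub>+(0,k)\<close>, and both cases depend
  only on the values of \<open>\<psi>\<^sub>+\<close> and \<open>\<psi>\<^sub>+'\<close> at \<open>0\<close>.

  Since \<open>q\<close> is merely integrable, \<open>\<psi>\<^sub>+'\<close> is only absolutely continuous. The calculus of such functions
  is reduced to one product rule (\<open>primitive_on_mult\<close>), which also yields Gronwall's inequality with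
  an integrable kernel and the convergence of Picard's series. The Picard iterates are finite sums
  \<open>\<Sum> e\<^sub>j(k) c\<^sub>j(x)\<close> with entire \<open>e\<^sub>j\<close>, so their locally uniform limit \<open>\<psi>\<^sub>+(x,\<cdot>)\<close> is entire.
\<close>

section \<open>Primitives of integrable functions\<close>

lemma absolutely_integrable_continuous_times:
  fixes F g :: "real \<Rightarrow> 'a::{euclidean_space, real_normed_algebra}"
  assumes F: "continuous_on {a..b} F" and g: "g absolutely_integrable_on {a..b}"
  shows "(\<lambda>t. F t * g t) absolutely_integrable_on {a..b}"
  and "(\<lambda>t. g t * F t) absolutely_integrable_on {a..b}"
proof -
  have bil: "bilinear ((*) :: 'a \<Rightarrow> 'a \<Rightarrow> 'a)"
    by (simp add: bilinear_conv_bounded_bilinear bounded_bilinear_mult)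
  have bil': "bilinear (\<lambda>x y :: 'a. y * x)"
    using bil by (simp add: bilinear_def)
  have m: "F \<in> borel_measurable (lebesgue_on {a..b})"
    by (rule continuous_imp_measurable_on_sets_lebesgue[OF F]) auto
  have bd: "bounded (F ` {a..b})"
    by (intro compact_imp_bounded compact_continuous_image F) auto
  show "(\<lambda>t. F t * g t) absolutely_integrable_on {a..b}"
    using absolutely_integrable_bounded_measurable_product[OF bil m _ bd g] by simp
  show "(\<lambda>t. g t * F t) absolutely_integrable_on {a..b}"
    using absolutely_integrable_bounded_measurable_product[OF bil' m _ bd g] by simp
qed

text \<open>For integrable \<open>h\<close> this says that \<open>G\<close> is absolutely continuous with \<open>G' = h\<close> almost everywhere. The
  integral form is used because \<open>G\<close> need not be differentiable at every point.\<close>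

definition primitive_on ::
  "real \<Rightarrow> real \<Rightarrow> (real \<Rightarrow> 'a::euclidean_space) \<Rightarrow> (real \<Rightarrow> 'a) \<Rightarrow> bool" where
  "primitive_on a b h G \<longleftrightarrow> h absolutely_integrable_on {a..b} \<and>
     (\<forall>x y. a \<le> x \<longrightarrow> x \<le> y \<longrightarrow> y \<le> b \<longrightarrow> (h has_integral (G y - G x)) {x..y})"

lemma primitive_onD:
  assumes "primitive_on a b h G" "a \<le> x" "x \<le> y" "y \<le> b"
  shows "(h has_integral (G y - G x)) {x..y}"
  using assms by (auto simp: primitive_on_def)

lemma primitive_on_absolutely_integrable:
  "primitive_on a b h G \<Longrightarrow> h absolutely_integrable_on {a..b}"
  by (auto simp: primitive_on_def)

lemma primitive_on_subset:
  assumes "primitive_on a b h G" "a \<le> a'" "b' \<le> b"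
  shows "primitive_on a' b' h G"
  using assms by (auto simp: primitive_on_def intro: absolutely_integrable_on_subinterval)

lemma primitive_on_continuous:
  assumes "primitive_on a b h G"
  shows "continuous_on {a..b} G"
proof -
  have "h integrable_on {a..b}"
    using assms set_lebesgue_integral_eq_integral(1) by (auto simp: primitive_on_def)
  then have "continuous_on {a..b} (\<lambda>x. G a + integral {a..x} h)"
    by (intro continuous_intros indefinite_integral_continuous_1)
  moreover have "G a + integral {a..x} h = G x" if "x \<in> {a..b}" for x
    using primitive_onD[OF assms, of a x] that by (auto dest!: integral_unique)
  ultimately show ?thesis by (rule continuous_on_eq)
qed

lemma primitive_on_spike:
  assumes "primitive_on a b h G" "negligible N" "\<And>t. t \<in> {a..b} - N \<Longrightarrow> h' t = h t"
    and "\<And>x. x \<in> {a..b} \<Longrightarrow> G' x = G x"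
  shows "primitive_on a b h' G'"
proof -
  have "h' absolutely_integrable_on {a..b}"
    using absolutely_integrable_spike[OF primitive_on_absolutely_integrable[OF assms(1)] assms(2), of h'] assms(3)
    by auto
  moreover have "(h' has_integral (G' y - G' x)) {x..y}" if "a \<le> x" "x \<le> y" "y \<le> b" for x y
    using has_integral_spike[OF assms(2) _ primitive_onD[OF assms(1) that], of h'] assms(3,4) that by auto
  ultimately show ?thesis by (auto simp: primitive_on_def)
qed

lemma primitive_on_combine:
  assumes ab: "primitive_on a b h G" and bc: "primitive_on b c h G" and "a \<le> b" "b \<le> c"
  shows "primitive_on a c h G"
proof -
  have "h absolutely_integrable_on {a..c}"
    using absolutely_integrable_on_combine[where c = b] assms by (auto simp: primitive_on_def)
  moreover have "(h has_integral (G y - G x)) {x..y}" if xy: "a \<le> x" "x \<le> y" "y \<le> c" for x y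
  proof -
    consider "y \<le> b" | "b \<le> x" | "x \<le> b" "b \<le> y" by linarith
    then show ?thesis
    proof cases
      case 3
      have "(h has_integral ((G b - G x) + (G y - G b))) {x..y}"
        using 3 xy by (intro has_integral_combine[of x b y] primitive_onD[OF ab] primitive_onD[OF bc]) auto
      then show ?thesis by simp
    qed (use xy primitive_onD[OF ab] primitive_onD[OF bc] in auto)
  qed
  ultimately show ?thesis by (auto simp: primitive_on_def)
qed

lemma primitive_on_C1:
  assumes "continuous_on {a..b} h"
    and "\<And>x. x \<in> {a..b} \<Longrightarrow> (G has_vector_derivative h x) (at x within {a..b})"
  shows "primitive_on a b h G"
proof -
  have "(h has_integral (G y - G x)) {x..y}" if "a \<le> x" "x \<le> y" "y \<le> b" for x y
    using that by (intro fundamental_theorem_of_calculus has_vector_derivative_within_subset[OF assms(2)]) auto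
  then show ?thesis using absolutely_integrable_continuous_real[OF assms(1)] by (auto simp: primitive_on_def)
qed

lemma primitive_on_has_vector_derivative:
  assumes "primitive_on a b h G" "continuous_on {a..b} h" "x \<in> {a..b}"
  shows "(G has_vector_derivative h x) (at x within {a..b})"
proof -
  have "((\<lambda>u. integral {a..u} h) has_vector_derivative h x) (at x within {a..b})"
    by (rule integral_has_vector_derivative[OF assms(2,3)])
  then have "((\<lambda>u. G a + integral {a..u} h) has_vector_derivative h x) (at x within {a..b})"
    by (auto intro!: derivative_eq_intros)
  then show ?thesis
  proof (rule has_vector_derivative_transform[rotated 2])
    show "G u = G a + integral {a..u} h" if "u \<in> {a..b}" for u
      using primitive_onD[OF assms(1), of a u] that by (auto dest!: integral_unique)
  qed fact
qed

lemma primitive_on_uminus: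
  assumes "primitive_on a b h G"
  shows "primitive_on a b (\<lambda>t. - h t) (\<lambda>x. - G x)"
proof -
  have "((\<lambda>t. - h t) has_integral (- G y - - G x)) {x..y}" if "a \<le> x" "x \<le> y" "y \<le> b" for x y
    using has_integral_neg[OF primitive_onD[OF assms that]] by simp
  then show ?thesis using assms
    by (simp add: primitive_on_def absolutely_integrable_on_def integrable_neg_iff)
qed

lemma primitive_on_diff:
  assumes "primitive_on a b h1 G1" "primitive_on a b h2 G2"
  shows "primitive_on a b (\<lambda>t. h1 t - h2 t) (\<lambda>x. G1 x - G2 x)"
proof -
  have "((\<lambda>t. h1 t - h2 t) has_integral ((G1 y - G2 y) - (G1 x - G2 x))) {x..y}" if "a \<le> x" "x \<le> y" "y \<le> b" for x y
    using has_integral_diff[OF primitive_onD[OF assms(1) that] primitive_onD[OF assms(2) that]]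
    by (simp add: algebra_simps)
  then show ?thesis using assms by (auto simp: primitive_on_def intro: set_integral_diff(1))
qed

lemma primitive_on_add:
  assumes "primitive_on a b h1 G1" "primitive_on a b h2 G2"
  shows "primitive_on a b (\<lambda>t. h1 t + h2 t) (\<lambda>x. G1 x + G2 x)"
  using primitive_on_diff[OF assms(1) primitive_on_uminus[OF assms(2)]] by simp

lemma primitive_on_cmult:
  fixes c :: complex
  assumes "primitive_on a b h G"
  shows "primitive_on a b (\<lambda>t. c * h t) (\<lambda>x. c * G x)"
proof -
  have "((\<lambda>t. c * h t) has_integral (c * G y - c * G x)) {x..y}" if "a \<le> x" "x \<le> y" "y \<le> b" for x y
    using has_integral_mult_right[OF primitive_onD[OF assms that], of c] by (simp add: algebra_simps)
  then show ?thesis using assms absolutely_integrable_continuous_times(1)[of a b "\<lambda>_. c" h]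
    by (auto simp: primitive_on_def)
qed

lemma primitive_on_cnj:
  assumes "primitive_on a b h G"
  shows "primitive_on a b (\<lambda>t. cnj (h t)) (\<lambda>x. cnj (G x))"
proof -
  have "((\<lambda>t. cnj (h t)) has_integral (cnj (G y) - cnj (G x))) {x..y}" if "a \<le> x" "x \<le> y" "y \<le> b" for x y
    using has_integral_cnj[THEN iffD2, OF primitive_onD[OF assms that]] by (simp add: o_def)
  moreover have "(\<lambda>t. cnj (h t)) absolutely_integrable_on {a..b}"
    using absolutely_integrable_linear[OF primitive_on_absolutely_integrable[OF assms] bounded_linear_cnj]
    by (simp add: o_def)
  ultimately show ?thesis by (auto simp: primitive_on_def)
qed

lemma primitive_on_reflect:
  assumes "primitive_on a b h G"
  shows "primitive_on (- b) (- a) (\<lambda>t. - h (- t)) (\<lambda>x. G (- x))"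
proof -
  have "(\<lambda>t. h (- t)) absolutely_integrable_on {- b..- a}"
    using primitive_on_absolutely_integrable[OF assms] by simp
  then have "(\<lambda>t. - h (- t)) absolutely_integrable_on {- b..- a}"
    by (simp add: absolutely_integrable_on_def integrable_neg_iff)
  moreover have "((\<lambda>t. - h (- t)) has_integral (G (- y) - G (- x))) {x..y}"
    if "- b \<le> x" "x \<le> y" "y \<le> - a" for x y
  proof -
    have "(h has_integral (G (- x) - G (- y))) {- y..- x}"
      using primitive_onD[OF assms, of "- y" "- x"] that by auto
    then have "((\<lambda>t. h (- t)) has_integral (G (- x) - G (- y))) {x..y}"
      by (subst (asm) has_integral_reflect_real[symmetric]) simp
    from has_integral_neg[OF this] show ?thesis by simp
  qed
  ultimately show ?thesis by (auto simp: primitive_on_def)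
qed

lemma primitive_on_integral_right:
  assumes "h absolutely_integrable_on {a..b}"
  shows "primitive_on a b h (\<lambda>x. - integral {x..b} h)"
proof -
  have "(h has_integral (- integral {y..b} h - - integral {x..b} h)) {x..y}"
    if "a \<le> x" "x \<le> y" "y \<le> b" for x y
  proof -
    have i: "h integrable_on {x..b}" "h integrable_on {x..y}"
      using assms that by (auto simp: absolutely_integrable_on_def intro: integrable_subinterval_real)
    then have "integral {x..y} h = integral {x..b} h - integral {y..b} h"
      using Henstock_Kurzweil_Integration.integral_combine[of x y b h] that by (simp add: algebra_simps)
    then show ?thesis using i integrable_integral[OF i(2)] by simp
  qed
  then show ?thesis using assms by (auto simp: primitive_on_def)
qed

lemma primitive_on_right_endpoint:
  assumes h: "h absolutely_integrable_on {a..b}"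
    and G: "\<And>x. x \<in> {a..b} \<Longrightarrow> G x = c - integral {x..b} h"
  shows "primitive_on a b h G"
proof -
  have "primitive_on a b h (\<lambda>x. - integral {x..b} h + c)"
    using primitive_on_integral_right[OF h] by (simp add: primitive_on_def)
  then show ?thesis by (rule primitive_on_spike[of _ _ _ _ "{}"]) (auto simp: G)
qed

text \<open>An estimate between additive interval functions that holds on short intervals holds on all
  intervals, by cutting into short pieces. It replaces pointwise differentiation for functions that
  are only absolutely continuous.\<close>

lemma norm_additive_le_of_local:
  fixes D :: "real \<Rightarrow> real \<Rightarrow> 'a::real_normed_vector" and \<mu> :: "real \<Rightarrow> real \<Rightarrow> real"
  assumes ab: "a \<le> b" and \<delta>: "\<delta> > 0"
    and D: "\<And>x y z. a \<le> x \<Longrightarrow> x \<le> y \<Longrightarrow> y \<le> z \<Longrightarrow> z \<le> b \<Longrightarrow> D x z = D x y + D y z"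
    and \<mu>: "\<And>x y z. a \<le> x \<Longrightarrow> x \<le> y \<Longrightarrow> y \<le> z \<Longrightarrow> z \<le> b \<Longrightarrow> \<mu> x z = \<mu> x y + \<mu> y z"
    and loc: "\<And>x y. a \<le> x \<Longrightarrow> x \<le> y \<Longrightarrow> y \<le> b \<Longrightarrow> y - x < \<delta> \<Longrightarrow> norm (D x y) \<le> \<mu> x y"
  shows "norm (D a b) \<le> \<mu> a b"
proof -
  have *: "norm (D x b) \<le> \<mu> x b" if "a \<le> x" "x \<le> b" "b - x \<le> real n * (\<delta>/2)" for n x
    using that
  proof (induction n arbitrary: x)
    case 0
    then show ?case using loc[of x b] \<delta> by auto
  next
    case (Suc n)
    show ?case
    proof (cases "b - x < \<delta>")
      case True
      then show ?thesis using loc[of x b] Suc.prems by auto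
    next
      case False
      define y where "y = x + \<delta>/2"
      have y: "x \<le> y" "y \<le> b" "a \<le> y" "y - x < \<delta>" "b - y \<le> real n * (\<delta>/2)"
        using False \<delta> Suc.prems by (auto simp: y_def algebra_simps)
      have "norm (D x b) \<le> norm (D x y) + norm (D y b)"
        using D[of x y b] Suc.prems y by (auto intro: norm_triangle_ineq)
      also have "\<dots> \<le> \<mu> x y + \<mu> y b"
        using loc[of x y] Suc.IH[of y] Suc.prems y by (intro add_mono) auto
      also have "\<dots> = \<mu> x b" using \<mu>[of x y b] Suc.prems y by auto
      finally show ?thesis .
    qed
  qed
  obtain n where "(b - a) / (\<delta>/2) \<le> real n" using real_arch_simple by blast
  then have "b - a \<le> real n * (\<delta>/2)" using \<delta> by (simp add: field_simps)
  then show ?thesis using *[of a n] ab by auto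
qed

text \<open>The product rule. On a short interval \<open>{u..v}\<close> the defect
  \<open>\<integral> (fG + Fg) - (F v G v - F u G u)\<close> equals \<open>\<integral> f (G - G u) + (F - F v) g\<close>, and by uniform continuity
  of \<open>F\<close> and \<open>G\<close> this is at most \<open>\<epsilon> \<integral> (\<bar>f\<bar> + \<bar>g\<bar>)\<close>. By additivity the bound extends to the whole
  interval, and \<open>\<epsilon>\<close> is arbitrary.\<close>

lemma primitive_on_mult:
  fixes f g F G :: "real \<Rightarrow> 'a::{euclidean_space, real_normed_algebra}"
  assumes F: "primitive_on a b f F" and G: "primitive_on a b g G"
  shows "primitive_on a b (\<lambda>t. f t * G t + F t * g t) (\<lambda>t. F t * G t)"
proof -
  let ?c = "\<lambda>t. f t * G t + F t * g t" and ?m = "\<lambda>t. norm (f t) + norm (g t)"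
  note cF = primitive_on_continuous[OF F] and cG = primitive_on_continuous[OF G]
  note aF = primitive_on_absolutely_integrable[OF F] and aG = primitive_on_absolutely_integrable[OF G]
  have ac: "?c absolutely_integrable_on {a..b}"
    using absolutely_integrable_continuous_times[OF cG aF] absolutely_integrable_continuous_times[OF cF aG]
    by (intro set_integral_add)
  have im: "?m integrable_on {x..y}" if "a \<le> x" "y \<le> b" for x y
  proof -
    have "?m integrable_on {a..b}"
      using aF aG by (intro integrable_add) (auto simp: absolutely_integrable_on_def)
    then show ?thesis using that by (auto intro: integrable_subinterval_real)
  qed
  have ic: "?c integrable_on {x..y}" if "a \<le> x" "y \<le> b" for x y
    using ac that by (auto simp: absolutely_integrable_on_def intro: integrable_subinterval_real)
  have hi: "(?c has_integral (F y * G y - F x * G x)) {x..y}" if xy: "a \<le> x" "x \<le> y" "y \<le> b" for x y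
  proof -
    define D where "D = (\<lambda>u v. integral {u..v} ?c - (F v * G v - F u * G u))"
    have bd: "norm (D x y) \<le> \<epsilon> * integral {x..y} ?m" if \<epsilon>: "\<epsilon> > 0" for \<epsilon>
    proof -
      obtain d1 where d1: "d1 > 0" "\<And>s t. s \<in> {a..b} \<Longrightarrow> t \<in> {a..b} \<Longrightarrow> dist t s < d1 \<Longrightarrow> dist (F t) (F s) < \<epsilon>"
        using compact_uniformly_continuous[OF cF] \<epsilon> unfolding uniformly_continuous_on_def by (metis compact_Icc)
      obtain d2 where d2: "d2 > 0" "\<And>s t. s \<in> {a..b} \<Longrightarrow> t \<in> {a..b} \<Longrightarrow> dist t s < d2 \<Longrightarrow> dist (G t) (G s) < \<epsilon>"
        using compact_uniformly_continuous[OF cG] \<epsilon> unfolding uniformly_continuous_on_def by (metis compact_Icc)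
      show ?thesis
      proof (rule norm_additive_le_of_local[where \<delta> = "min d1 d2" and D = D and \<mu> = "\<lambda>u v. \<epsilon> * integral {u..v} ?m", OF \<open>x \<le> y\<close>])
        show "min d1 d2 > 0" using d1 d2 by auto
        fix u v w assume u: "x \<le> u" "u \<le> v" "v \<le> w" "w \<le> y"
        have "integral {u..w} ?c = integral {u..v} ?c + integral {v..w} ?c"
          using Henstock_Kurzweil_Integration.integral_combine[OF u(2,3), of ?c] ic[of u w] u xy by auto
        then show "D u w = D u v + D v w" by (simp add: D_def)
        have "integral {u..w} ?m = integral {u..v} ?m + integral {v..w} ?m"
          using Henstock_Kurzweil_Integration.integral_combine[OF u(2,3), of ?m] im[of u w] u xy by auto
        then show "\<epsilon> * integral {u..w} ?m = \<epsilon> * integral {u..v} ?m + \<epsilon> * integral {v..w} ?m"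
          by (simp add: algebra_simps)
      next
        fix u v assume u: "x \<le> u" "u \<le> v" "v \<le> y" "v - u < min d1 d2"
        let ?e = "\<lambda>t. ?c t - (f t * G u + F v * g t)"
        have "((\<lambda>t. f t * G u + F v * g t) has_integral ((F v - F u) * G u + F v * (G v - G u))) {u..v}"
          using u xy by (intro has_integral_add has_integral_mult_left has_integral_mult_right
               primitive_onD[OF F] primitive_onD[OF G]) auto
        then have e: "(?e has_integral D u v) {u..v}"
          using has_integral_diff[OF integrable_integral[OF ic[of u v]], of "\<lambda>t. f t * G u + F v * g t"] u xy
          by (fastforce simp: D_def algebra_simps)
        have "norm (integral {u..v} ?e) \<le> integral {u..v} (\<lambda>t. \<epsilon> * ?m t)"
        proof (rule Henstock_Kurzweil_Integration.integral_norm_bound_integral)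
          show "?e integrable_on {u..v}" using e by blast
          show "(\<lambda>t. \<epsilon> * ?m t) integrable_on {u..v}"
            using im[of u v] u xy by (intro integrable_on_mult_right) auto
          fix t assume t: "t \<in> {u..v}"
          have "?e t = f t * (G t - G u) + (F t - F v) * g t" by (simp add: algebra_simps)
          then have "norm (?e t) \<le> norm (f t) * norm (G t - G u) + norm (F t - F v) * norm (g t)"
            by (metis norm_triangle_le add_mono norm_mult_ineq)
          also have "\<dots> \<le> norm (f t) * \<epsilon> + \<epsilon> * norm (g t)"
            using d1(2)[of v t] d2(2)[of u t] t u xy
            by (intro add_mono mult_left_mono mult_right_mono) (auto simp: dist_norm)
          finally show "norm (?e t) \<le> \<epsilon> * ?m t" by (simp add: algebra_simps)
        qed
        then show "norm (D u v) \<le> \<epsilon> * integral {u..v} ?m"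
          using e by (simp add: integral_unique)
      qed
    qed
    have "norm (D x y) \<le> 0"
    proof (rule field_le_epsilon)
      fix e :: real assume e: "e > 0"
      have m0: "integral {x..y} ?m \<ge> 0" by (intro integral_nonneg im) (use xy in auto)
      have "norm (D x y) \<le> (e / (1 + integral {x..y} ?m)) * integral {x..y} ?m"
        using e m0 by (intro bd divide_pos_pos) auto
      also have "\<dots> \<le> e" using e m0 by (auto simp: field_simps)
      finally show "norm (D x y) \<le> 0 + e" by simp
    qed
    then have "integral {x..y} ?c = F y * G y - F x * G x" by (simp add: D_def)
    then show ?thesis using ic[of x y] xy by (metis integrable_integral)
  qed
  show ?thesis using ac hi by (auto simp: primitive_on_def)
qed

section \<open>Gronwall's inequality with an integrable kernel\<close>

text \<open>The tail integral \<open>P\<close> has derivative \<open>- p\<close>, so repeated use of the product rule differentiates its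
  powers. This gives the factorials in Gronwall's inequality and in Picard's series.\<close>

lemma integral_mult_power_tail_integral:
  fixes p :: "real \<Rightarrow> real"
  assumes p: "p absolutely_integrable_on {a..b}" and x: "a \<le> x" "x \<le> b"
  defines "P \<equiv> \<lambda>x. integral {x..b} p"
  shows "((\<lambda>t. p t * (P t ^ n / fact n)) has_integral P x ^ Suc n / fact (Suc n)) {x..b}"
proof -
  have P: "primitive_on a b (\<lambda>t. - p t) P"
    using primitive_on_uminus[OF primitive_on_integral_right[OF p]] by (simp add: P_def)
  have pr: "primitive_on a b (\<lambda>t. real (Suc n) * (- p t) * P t ^ n) (\<lambda>t. P t ^ Suc n)" for n
  proof (induction n)
    case 0
    then show ?case using P by simp
  next
    case (Suc n)
    have "(\<lambda>t. real (Suc n) * (- p t) * P t ^ n * P t + P t ^ Suc n * (- p t))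
        = (\<lambda>t. real (Suc (Suc n)) * (- p t) * P t ^ Suc n)"
      by (simp add: fun_eq_iff algebra_simps)
    with primitive_on_mult[OF Suc P] show ?case
      by (simp add: mult.commute[of _ "P _"])
  qed
  have "((\<lambda>t. (- 1 / fact (Suc n)) * (real (Suc n) * (- p t) * P t ^ n)) has_integral
      (- 1 / fact (Suc n)) * (P b ^ Suc n - P x ^ Suc n)) {x..b}"
    using x by (intro has_integral_mult_right primitive_onD[OF pr]) auto
  moreover have "(\<lambda>t. (- 1 / fact (Suc n)) * (real (Suc n) * (- p t) * P t ^ n)) = (\<lambda>t. p t * (P t ^ n / fact n))"
    by (simp add: fun_eq_iff divide_simps del: of_nat_Suc)
  ultimately show ?thesis by (simp add: P_def)
qed

text \<open>Inserting the hypothesis into itself \<open>n\<close> times bounds \<open>u\<close> by \<open>c\<close> times a partial sum of the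
  exponential series of \<open>P = \<integral> p\<close>, plus a remainder \<open>K P\<^sup>n / n!\<close> that tends to \<open>0\<close>.\<close>

lemma gronwall_integrable_kernel:
  fixes p u :: "real \<Rightarrow> real"
  assumes p: "p absolutely_integrable_on {a..b}" and p0: "\<And>t. t \<in> {a..b} \<Longrightarrow> 0 \<le> p t"
    and u: "continuous_on {a..b} u"
    and le: "\<And>x. x \<in> {a..b} \<Longrightarrow> u x \<le> c + integral {x..b} (\<lambda>t. p t * u t)"
    and x: "x \<in> {a..b}"
  shows "u x \<le> c * exp (integral {x..b} p)"
proof -
  define P where "P = (\<lambda>x. integral {x..b} p)"
  obtain K where K: "\<And>t. t \<in> {a..b} \<Longrightarrow> \<bar>u t\<bar> \<le> K"
    using compact_imp_bounded[OF compact_continuous_image[OF u compact_Icc]]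
    unfolding bounded_iff by fastforce
  have "u x \<le> c * (\<Sum>j<n. P x ^ j / fact j) + K * (P x ^ n / fact n)" if "x \<in> {a..b}" for n x
    using that
  proof (induction n arbitrary: x)
    case 0
    then show ?case using K[of x] by auto
  next
    case (Suc n)
    let ?S = "\<lambda>t. c * (\<Sum>j<n. p t * (P t ^ j / fact j)) + K * (p t * (P t ^ n / fact n))"
    have hi: "(?S has_integral (c * (\<Sum>j<n. P x ^ Suc j / fact (Suc j)) + K * (P x ^ Suc n / fact (Suc n)))) {x..b}"
      unfolding P_def using Suc.prems
      by (intro has_integral_add has_integral_mult_right has_integral_sum integral_mult_power_tail_integral[OF p]) auto
    have ipu: "(\<lambda>t. p t * u t) integrable_on {x..b}"
      using absolutely_integrable_continuous_times(2)[OF u p] Suc.prems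
      by (auto simp: absolutely_integrable_on_def intro: integrable_subinterval_real)
    have "integral {x..b} (\<lambda>t. p t * u t) \<le> integral {x..b} ?S"
    proof (rule integral_le[OF ipu])
      show "?S integrable_on {x..b}" using hi by blast
      fix t assume t: "t \<in> {x..b}"
      then have "p t * u t \<le> p t * (c * (\<Sum>j<n. P t ^ j / fact j) + K * (P t ^ n / fact n))"
        using Suc.IH[of t] Suc.prems by (intro mult_left_mono p0) auto
      then show "p t * u t \<le> ?S t" by (simp add: algebra_simps sum_distrib_left)
    qed
    then have "u x \<le> c + (c * (\<Sum>j<n. P x ^ Suc j / fact (Suc j)) + K * (P x ^ Suc n / fact (Suc n)))"
      using le[OF Suc.prems] integral_unique[OF hi] by linarith
    then show ?case by (simp add: sum.lessThan_Suc_shift algebra_simps del: sum.lessThan_Suc)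
  qed
  note * = this[OF x]
  have s: "(\<lambda>j. P x ^ j / fact j) sums exp (P x)"
    using exp_converges[of "P x"] by (simp add: scaleR_conv_of_real field_simps)
  have "(\<lambda>n. c * (\<Sum>j<n. P x ^ j / fact j) + K * (P x ^ n / fact n)) \<longlonglongrightarrow> c * exp (P x) + K * 0"
    using s summable_LIMSEQ_zero[OF sums_summable[OF s]] by (intro tendsto_intros) (auto simp: sums_def)
  then have "u x \<le> c * exp (P x) + K * 0"
    by (rule LIMSEQ_le_const) (use * in auto)
  then show ?thesis by (simp add: P_def)
qed

section \<open>Picard's series for the Jost solution\<close>

text \<open>Finite sums \<open>\<Sum> e\<^sub>j(k) c\<^sub>j(x)\<close> with entire \<open>e\<^sub>j\<close> and continuous \<open>c\<^sub>j\<close>. Integration in \<open>x\<close> acts on the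
  \<open>c\<^sub>j\<close> alone and preserves this class, so the iterates are entire in \<open>k\<close> without any theorem on
  holomorphic dependence of integrals on a parameter.\<close>

inductive separated_entire :: "real \<Rightarrow> real \<Rightarrow> (complex \<Rightarrow> real \<Rightarrow> complex) \<Rightarrow> bool" for a b where
  product: "e holomorphic_on UNIV \<Longrightarrow> continuous_on {a..b} c \<Longrightarrow> separated_entire a b (\<lambda>k x. e k * c x)"
| add: "separated_entire a b F \<Longrightarrow> separated_entire a b G \<Longrightarrow> separated_entire a b (\<lambda>k x. F k x + G k x)"
| cong: "separated_entire a b F \<Longrightarrow> (\<And>k x. x \<in> {a..b} \<Longrightarrow> G k x = F k x) \<Longrightarrow> separated_entire a b G"

lemma separated_entire_holomorphic:
  assumes "separated_entire a b F" "x \<in> {a..b}"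
  shows "(\<lambda>k. F k x) holomorphic_on UNIV"
  using assms
proof induction
  case (cong F G)
  then show ?case by (simp cong: holomorphic_cong)
qed (auto intro!: holomorphic_intros)

lemma separated_entire_continuous:
  assumes "separated_entire a b F"
  shows "continuous_on {a..b} (F k)"
  using assms
proof induction
  case (cong F G)
  then show ?case by (metis continuous_on_eq)
qed (auto intro!: continuous_intros)

lemma separated_entire_mult:
  assumes "separated_entire a b F" "d holomorphic_on UNIV"
  shows "separated_entire a b (\<lambda>k x. d k * F k x)"
  using assms
proof induction
  case (product e c)
  then show ?case
    using separated_entire.product[of "\<lambda>k. d k * e k" a b c] by (auto simp: mult.assoc intro: holomorphic_intros)
next
  case (add F G)
  then show ?case using separated_entire.add by (fastforce simp: distrib_left)
next
  case (cong F G)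
  then show ?case using separated_entire.cong[of a b "\<lambda>k x. d k * F k x"] by simp
qed

lemma separated_entire_tail_integral:
  assumes "separated_entire a b F" and p: "p absolutely_integrable_on {a..b}"
  shows "separated_entire a b (\<lambda>k x. integral {x..b} (\<lambda>t. p t * F k t))"
  using assms(1)
proof induction
  case (product e c)
  have pr: "primitive_on a b (\<lambda>t. p t * c t) (\<lambda>x. - integral {x..b} (\<lambda>t. p t * c t))"
    by (intro primitive_on_integral_right absolutely_integrable_continuous_times product p)
  have "continuous_on {a..b} (\<lambda>x. - (- integral {x..b} (\<lambda>t. p t * c t)))"
    by (intro continuous_on_minus primitive_on_continuous[OF pr])
  then have "separated_entire a b (\<lambda>k x. e k * integral {x..b} (\<lambda>t. p t * c t))"
    by (intro separated_entire.product product) auto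
  then show ?case by (simp add: mult.left_commute)
next
  case (add F G)
  show ?case
  proof (rule separated_entire.cong[OF separated_entire.add[OF add.IH]])
    fix k x assume x: "x \<in> {a..b}"
    have "(\<lambda>t. p t * F k t) integrable_on {x..b}" if "separated_entire a b F" for F
    proof -
      have "(\<lambda>t. p t * F k t) absolutely_integrable_on {a..b}"
        by (intro absolutely_integrable_continuous_times p separated_entire_continuous[OF that])
      then show ?thesis using x
        by (auto simp: absolutely_integrable_on_def intro: integrable_subinterval_real)
    qed
    from this[OF add.hyps(1)] this[OF add.hyps(2)]
    show "integral {x..b} (\<lambda>t. p t * (F k t + G k t)) =
        integral {x..b} (\<lambda>t. p t * F k t) + integral {x..b} (\<lambda>t. p t * G k t)"
      unfolding distrib_left by (rule Henstock_Kurzweil_Integration.integral_add)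
  qed
next
  case (cong F G)
  show ?case
  proof (rule separated_entire.cong[OF cong.IH])
    fix k x assume "x \<in> {a..b}"
    then show "integral {x..b} (\<lambda>t. p t * G k t) = integral {x..b} (\<lambda>t. p t * F k t)"
      by (intro Henstock_Kurzweil_Integration.integral_cong) (auto simp: cong.hyps)
  qed
qed

text \<open>The \<open>n\<close>-th term of the series for \<open>(f, f')\<close> obtained from the first order system
  \<open>f' = g\<close>, \<open>g' = (q - k\<^sup>2) f\<close> with the data of \<open>e\<^sup>i\<^sup>k\<^sup>x\<close> at \<open>b\<close>, solved to the left of \<open>b\<close>.\<close>

primrec picard :: "(real \<Rightarrow> real) \<Rightarrow> real \<Rightarrow> nat \<Rightarrow> complex \<Rightarrow> real \<Rightarrow> complex \<times> complex" where
  "picard q b 0 = (\<lambda>k x. (exp (\<i> * k * b), \<i> * k * exp (\<i> * k * b)))"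
| "picard q b (Suc n) = (\<lambda>k x. (- integral {x..b} (\<lambda>t. snd (picard q b n k t)),
      - integral {x..b} (\<lambda>t. (q t - k\<^sup>2) * fst (picard q b n k t))))"

lemma absolutely_integrable_complex_potential:
  assumes "q absolutely_integrable_on {a..b :: real}"
  shows "(\<lambda>t. complex_of_real (q t)) absolutely_integrable_on {a..b}"
    "(\<lambda>t. complex_of_real (q t) - k\<^sup>2) absolutely_integrable_on {a..b}"
proof -
  show *: "(\<lambda>t. complex_of_real (q t)) absolutely_integrable_on {a..b}"
    using absolutely_integrable_linear[OF assms bounded_linear_of_real] by (simp add: o_def)
  show "(\<lambda>t. complex_of_real (q t) - k\<^sup>2) absolutely_integrable_on {a..b}"
    by (intro set_integral_diff(1) * absolutely_integrable_continuous_real continuous_intros)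
qed

lemma separated_entire_picard:
  assumes q: "q absolutely_integrable_on {a..b}"
  shows "separated_entire a b (\<lambda>k x. fst (picard q b n k x)) \<and>
         separated_entire a b (\<lambda>k x. snd (picard q b n k x))"
proof (induction n)
  case 0
  have "separated_entire a b (\<lambda>k x. exp (\<i> * k * b) * 1)"
       "separated_entire a b (\<lambda>k x. (\<i> * k * exp (\<i> * k * b)) * 1)"
    by (intro separated_entire.product holomorphic_intros continuous_intros)+
  then show ?case by simp
next
  case (Suc n)
  let ?f = "\<lambda>k x. fst (picard q b n k x)" and ?g = "\<lambda>k x. snd (picard q b n k x)"
  have f: "separated_entire a b ?f" and g: "separated_entire a b ?g" using Suc by auto
  have 1: "(\<lambda>t. 1 :: complex) absolutely_integrable_on {a..b}"
    by (intro absolutely_integrable_continuous_real continuous_intros)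
  have "separated_entire a b (\<lambda>k x. (-1) * integral {x..b} (\<lambda>t. 1 * ?g k t))"
    by (intro separated_entire_mult separated_entire_tail_integral g 1 holomorphic_intros)
  moreover have "separated_entire a b (\<lambda>k x. (-1) * integral {x..b} (\<lambda>t. (q t - k\<^sup>2) * ?f k t))"
  proof (rule separated_entire_mult)
    have *: "separated_entire a b (\<lambda>k x. integral {x..b} (\<lambda>t. complex_of_real (q t) * ?f k t)
        + (- (k\<^sup>2)) * integral {x..b} (\<lambda>t. 1 * ?f k t))"
      by (intro separated_entire.add separated_entire_mult separated_entire_tail_integral f 1
            absolutely_integrable_complex_potential q holomorphic_intros)
    show "separated_entire a b (\<lambda>k x. integral {x..b} (\<lambda>t. (q t - k\<^sup>2) * ?f k t))"
    proof (rule separated_entire.cong[OF *])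
      fix k x assume x: "x \<in> {a..b}"
      have "(\<lambda>t. complex_of_real (q t) * ?f k t) absolutely_integrable_on {a..b}"
        by (intro absolutely_integrable_continuous_times separated_entire_continuous[OF f]
            absolutely_integrable_complex_potential q)
      then have i1: "(\<lambda>t. complex_of_real (q t) * ?f k t) integrable_on {x..b}"
        using x by (auto simp: absolutely_integrable_on_def intro: integrable_subinterval_real)
      have i2: "(\<lambda>t. (- (k\<^sup>2)) * ?f k t) integrable_on {x..b}"
        using x by (intro integrable_continuous_real continuous_intros
            continuous_on_subset[OF separated_entire_continuous[OF f]]) auto
      have "integral {x..b} (\<lambda>t. (q t - k\<^sup>2) * ?f k t) =
          integral {x..b} (\<lambda>t. complex_of_real (q t) * ?f k t + (- (k\<^sup>2)) * ?f k t)"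
        by (intro Henstock_Kurzweil_Integration.integral_cong) (simp add: algebra_simps)
      also have "\<dots> = integral {x..b} (\<lambda>t. complex_of_real (q t) * ?f k t)
        + integral {x..b} (\<lambda>t. (- (k\<^sup>2)) * ?f k t)"
        by (rule Henstock_Kurzweil_Integration.integral_add[OF i1 i2])
      finally show "integral {x..b} (\<lambda>t. (q t - k\<^sup>2) * ?f k t) =
          integral {x..b} (\<lambda>t. complex_of_real (q t) * ?f k t) + (- (k\<^sup>2)) * integral {x..b} (\<lambda>t. 1 * ?f k t)"
        by simp
    qed
  qed (rule holomorphic_intros)
  ultimately show ?case by simp
qed

text \<open>Each step multiplies by a coefficient of modulus at most \<open>m\<close> and integrates; the bound is uniform
  for \<open>\<bar>k\<bar> \<le> \<rho>\<close>, as needed for a limit that is holomorphic in \<open>k\<close>.\<close>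

lemma norm_picard_le:
  fixes \<rho> :: real
  assumes q: "q absolutely_integrable_on {a..b}" and k: "cmod k \<le> \<rho>" and x: "x \<in> {a..b}"
  defines "m \<equiv> (\<lambda>t. \<bar>q t\<bar> + (1 + \<rho>\<^sup>2))" and "C \<equiv> (1 + \<rho>) * exp (\<rho> * \<bar>b\<bar>)"
  shows "cmod (fst (picard q b n k x)) \<le> C * (integral {x..b} m ^ n / fact n) \<and>
         cmod (snd (picard q b n k x)) \<le> C * (integral {x..b} m ^ n / fact n)"
  using x
proof (induction n arbitrary: x)
  case 0
  have \<rho>: "\<rho> \<ge> 0" using k norm_ge_zero order_trans by blast
  have "cmod (exp (\<i> * k * b)) \<le> exp (cmod (\<i> * k * b))" by (rule norm_exp)
  also have "\<dots> \<le> exp (\<rho> * \<bar>b\<bar>)"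
    unfolding exp_le_cancel_iff using k by (simp add: norm_mult mult_right_mono)
  finally have e: "cmod (exp (\<i> * k * b)) \<le> exp (\<rho> * \<bar>b\<bar>)" .
  have "cmod (\<i> * k * exp (\<i> * k * b)) \<le> \<rho> * exp (\<rho> * \<bar>b\<bar>)"
    unfolding norm_mult[of "\<i> * k"] using k e \<rho> by (intro mult_mono) (auto simp: norm_mult)
  moreover have "0 \<le> \<rho> * exp (\<rho> * \<bar>b\<bar>)" "0 \<le> exp (\<rho> * \<bar>b\<bar>)" using \<rho> by auto
  ultimately show ?case using e
    unfolding C_def picard.simps fst_conv snd_conv distrib_right power_0 fact_0 div_by_1 mult_1_right mult_1_left
    by linarith
next
  case (Suc n)
  have am: "m absolutely_integrable_on {a..b}"
    unfolding m_def by (intro set_integral_add(1) absolutely_integrable_norm[OF q, unfolded o_def real_norm_def]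
        absolutely_integrable_continuous_real[OF continuous_on_const])
  have hi: "((\<lambda>t. C * (m t * (integral {t..b} m ^ n / fact n))) has_integral
      C * (integral {x..b} m ^ Suc n / fact (Suc n))) {x..b}"
    using Suc.prems by (intro has_integral_mult_right integral_mult_power_tail_integral[OF am]) auto
  note sep = separated_entire_picard[OF q, of n]
  have *: "cmod (- integral {x..b} (\<lambda>t. p t * h t)) \<le> C * (integral {x..b} m ^ Suc n / fact (Suc n))"
    if p: "p absolutely_integrable_on {a..b}" and pm: "\<And>t. cmod (p t) \<le> m t"
      and h: "continuous_on {a..b} h"
      and hC: "\<And>t. t \<in> {a..b} \<Longrightarrow> cmod (h t) \<le> C * (integral {t..b} m ^ n / fact n)" for p h
  proof -
    have "norm (integral {x..b} (\<lambda>t. p t * h t)) \<le> integral {x..b} (\<lambda>t. C * (m t * (integral {t..b} m ^ n / fact n)))"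
    proof (rule Henstock_Kurzweil_Integration.integral_norm_bound_integral)
      show "(\<lambda>t. p t * h t) integrable_on {x..b}"
        using absolutely_integrable_continuous_times(2)[OF h p] Suc.prems
        by (auto simp: absolutely_integrable_on_def intro: integrable_subinterval_real)
      show "(\<lambda>t. C * (m t * (integral {t..b} m ^ n / fact n))) integrable_on {x..b}" using hi by blast
      fix t assume t: "t \<in> {x..b}"
      have "norm (p t * h t) \<le> m t * (C * (integral {t..b} m ^ n / fact n))"
        unfolding norm_mult using Suc.prems t pm[of t] order_trans[OF norm_ge_zero pm]
        by (intro mult_mono pm hC) auto
      then show "norm (p t * h t) \<le> C * (m t * (integral {t..b} m ^ n / fact n))" by (simp add: algebra_simps)
    qed
    then show ?thesis using integral_unique[OF hi] by simp
  qed
  have 1: "(\<lambda>t. 1 :: complex) absolutely_integrable_on {a..b}"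
    by (intro absolutely_integrable_continuous_real continuous_intros)
  have "cmod (- integral {x..b} (\<lambda>t. 1 * snd (picard q b n k t))) \<le> C * (integral {x..b} m ^ Suc n / fact (Suc n))"
    using Suc.IH by (intro * 1 separated_entire_continuous[of a b "\<lambda>k x. snd (picard q b n k x)"])
       (auto simp: sep, auto simp: m_def)
  moreover have "cmod (- integral {x..b} (\<lambda>t. (q t - k\<^sup>2) * fst (picard q b n k t))) \<le> C * (integral {x..b} m ^ Suc n / fact (Suc n))"
  proof (intro * separated_entire_continuous[of a b "\<lambda>k x. fst (picard q b n k x)"]
       absolutely_integrable_complex_potential q)
    fix t
    have "cmod (q t - k\<^sup>2) \<le> \<bar>q t\<bar> + (cmod k)\<^sup>2"
      by (metis norm_of_real norm_power norm_triangle_ineq4)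
    also have "\<dots> \<le> m t" using power_mono[OF k, of 2] by (auto simp: m_def)
    finally show "cmod (q t - k\<^sup>2) \<le> m t" .
  qed (use Suc.IH sep in auto)
  ultimately show ?case by simp
qed

lemma picard_uniformly_summable:
  fixes \<rho> :: real
  assumes q: "q absolutely_integrable_on {a..b}"
  obtains E where "summable E"
    "\<And>n k x. cmod k \<le> \<rho> \<Longrightarrow> x \<in> {a..b} \<Longrightarrow> cmod (fst (picard q b n k x)) \<le> E n"
    "\<And>n k x. cmod k \<le> \<rho> \<Longrightarrow> x \<in> {a..b} \<Longrightarrow> cmod (snd (picard q b n k x)) \<le> E n"
proof -
  define m where "m = (\<lambda>t. \<bar>q t\<bar> + (1 + \<rho>\<^sup>2))"
  define C where "C = (1 + \<rho>) * exp (\<rho> * \<bar>b\<bar>)"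
  define E where "E n = C * (integral {a..b} m ^ n / fact n)" for n
  have im: "m integrable_on {a..b}"
    unfolding m_def using q by (intro integrable_add) (auto simp: absolutely_integrable_on_def)
  have m0: "m t \<ge> 0" for t by (auto simp: m_def)
  have le: "C * (integral {x..b} m ^ n / fact n) \<le> E n" if "cmod k \<le> \<rho>" "x \<in> {a..b}" for n k x
  proof -
    have i: "m integrable_on {x..b}" using im that by (auto intro: integrable_subinterval_real)
    have "integral {x..b} m \<le> integral {a..b} m"
      by (rule integral_subset_le) (use that i im m0 in auto)
    moreover have "0 \<le> integral {x..b} m" by (rule integral_nonneg[OF i m0])
    moreover have "\<rho> \<ge> 0" using that norm_ge_zero order_trans by blast
    ultimately show ?thesis unfolding E_def C_def
      by (intro mult_left_mono divide_right_mono power_mono) auto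
  qed
  have "summable (\<lambda>n. integral {a..b} m ^ n / fact n)"
    using summable_exp[of "integral {a..b} m"] by (simp add: field_simps)
  then have "summable E" unfolding E_def by (rule summable_mult)
  then show ?thesis
  proof (rule that)
    fix n k x assume kx: "cmod k \<le> \<rho>" "x \<in> {a..b}"
    show "cmod (fst (picard q b n k x)) \<le> E n" "cmod (snd (picard q b n k x)) \<le> E n"
      using norm_picard_le[OF q kx, of n] le[OF kx, of n] unfolding m_def C_def by linarith+
  qed
qed

lemma sums_integral_mult_uniformly_summable:
  fixes u :: "nat \<Rightarrow> real \<Rightarrow> complex"
  assumes p: "p absolutely_integrable_on {a..b}" and u: "\<And>n. continuous_on {a..b} (u n)"
    and E: "summable E" "\<And>n t. t \<in> {a..b} \<Longrightarrow> cmod (u n t) \<le> E n"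
  shows "(\<lambda>n. integral {a..b} (\<lambda>t. p t * u n t)) sums integral {a..b} (\<lambda>t. p t * (\<Sum>n. u n t))"
proof -
  have i: "(\<lambda>t. p t * u n t) integrable_on {a..b}" for n
    using absolutely_integrable_continuous_times(2)[OF u p] by (auto simp: absolutely_integrable_on_def)
  have *: "(\<Sum>n<N. integral {a..b} (\<lambda>t. p t * u n t)) = integral {a..b} (\<lambda>t. \<Sum>n<N. p t * u n t)" for N
    by (rule integral_sum[symmetric]) (use i in auto)
  have "(\<lambda>N. integral {a..b} (\<lambda>t. \<Sum>n<N. p t * u n t)) \<longlonglongrightarrow> integral {a..b} (\<lambda>t. p t * (\<Sum>n. u n t))"
  proof (rule dominated_convergence(2))
    show "(\<lambda>t. \<Sum>n<N. p t * u n t) integrable_on {a..b}" for N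
      using i by (intro integrable_sum) auto
    show "(\<lambda>t. norm (p t) * suminf E) integrable_on {a..b}"
      using p by (intro integrable_on_mult_left) (auto simp: absolutely_integrable_on_def)
    fix t assume t: "t \<in> {a..b}"
    have E0: "0 \<le> E n" for n using E(2)[OF t] norm_ge_zero order_trans by blast
    show "norm (\<Sum>n<N. p t * u n t) \<le> norm (p t) * suminf E" for N
    proof -
      have "norm (\<Sum>n<N. u n t) \<le> (\<Sum>n<N. E n)" using E(2)[OF t] by (intro sum_norm_le) auto
      also have "\<dots> \<le> suminf E" by (intro sum_le_suminf E) (use E0 in auto)
      finally show ?thesis
        by (simp add: sum_distrib_left[symmetric] norm_mult mult_left_mono)
    qed
    have "summable (\<lambda>n. u n t)" by (rule summable_comparison_test'[OF E(1)]) (use E(2)[OF t] in auto)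
    then have "(\<lambda>n. p t * u n t) sums (p t * (\<Sum>n. u n t))" by (intro sums_mult summable_sums)
    then show "(\<lambda>N. \<Sum>n<N. p t * u n t) \<longlonglongrightarrow> p t * (\<Sum>n. u n t)" by (simp add: sums_def)
  qed
  then show ?thesis by (simp add: sums_def *)
qed

text \<open>The series converges uniformly for \<open>x\<close> in a compact interval and \<open>k\<close> in a disc, so the sum inherits
  holomorphy in \<open>k\<close> and continuity in \<open>x\<close>, and termwise integration turns the recursion into the
  integral equations of the system.\<close>

lemma picard_solution:
  fixes q :: "real \<Rightarrow> real" and b :: real and k :: complex and F G :: "complex \<Rightarrow> real \<Rightarrow> complex"
  assumes qa: "\<And>a. q absolutely_integrable_on {a..b}"
  defines "F \<equiv> \<lambda>k x. \<Sum>n. fst (picard q b n k x)" and "G \<equiv> \<lambda>k x. \<Sum>n. snd (picard q b n k x)"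
  shows "x \<le> b \<Longrightarrow> (\<lambda>k. F k x) holomorphic_on UNIV"
    and "x \<le> b \<Longrightarrow> (\<lambda>k. G k x) holomorphic_on UNIV"
    and "F k b = exp (\<i> * k * b)" and "G k b = \<i> * k * exp (\<i> * k * b)"
    and "primitive_on a b (G k) (F k)"
    and "primitive_on a b (\<lambda>t. (q t - k\<^sup>2) * F k t) (G k)"
proof -
  have sep: "separated_entire a b (\<lambda>k x. fst (picard q b n k x))"
       "separated_entire a b (\<lambda>k x. snd (picard q b n k x))" for n a
    using separated_entire_picard[OF qa] by auto
  have hol: "(\<lambda>k. \<Sum>n. u n k x) holomorphic_on UNIV"
    if u: "\<And>n. separated_entire x b (u n)"
      and E: "\<And>\<rho>. \<exists>E. summable E \<and> (\<forall>n k. cmod k \<le> \<rho> \<longrightarrow> cmod (u n k x) \<le> E n)"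
      and x: "x \<le> b" for u :: "nat \<Rightarrow> complex \<Rightarrow> real \<Rightarrow> complex" and x
  proof (rule holomorphic_uniform_sequence[where f = "\<lambda>N k. \<Sum>n<N. u n k x"])
    show "(\<lambda>k. \<Sum>n<N. u n k x) holomorphic_on UNIV" for N
      using separated_entire_holomorphic[OF u] x by (intro holomorphic_intros) auto
    fix k :: complex
    obtain E where "summable E" "\<And>n k'. cmod k' \<le> cmod k + 1 \<Longrightarrow> cmod (u n k' x) \<le> E n"
      using E[of "cmod k + 1"] by auto
    moreover have "cmod k' \<le> cmod k + 1" if "k' \<in> cball k 1" for k'
      using that norm_triangle_ineq2[of k' k] by (auto simp: dist_norm norm_minus_commute)
    ultimately have "uniform_limit (cball k 1) (\<lambda>N k. \<Sum>n<N. u n k x) (\<lambda>k. \<Sum>n. u n k x) sequentially"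
      by (intro Weierstrass_m_test) auto
    then show "\<exists>d>0. cball k d \<subseteq> UNIV \<and>
        uniform_limit (cball k d) (\<lambda>N k. \<Sum>n<N. u n k x) (\<lambda>k. \<Sum>n. u n k x) sequentially"
      by (intro exI[of _ 1]) auto
  qed auto
  show "(\<lambda>k. F k x) holomorphic_on UNIV" if "x \<le> b"
    unfolding F_def
  proof (rule hol[OF sep(1)])
    fix \<rho> :: real
    obtain E where "summable E"
      "\<And>n k y. cmod k \<le> \<rho> \<Longrightarrow> y \<in> {x..b} \<Longrightarrow> cmod (fst (picard q b n k y)) \<le> E n"
      by (rule picard_uniformly_summable[OF qa[of x], of \<rho>]) blast
    then show "\<exists>E. summable E \<and> (\<forall>n k. cmod k \<le> \<rho> \<longrightarrow> cmod (fst (picard q b n k x)) \<le> E n)"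
      using that by auto
  qed fact
  show "(\<lambda>k. G k x) holomorphic_on UNIV" if "x \<le> b"
    unfolding G_def
  proof (rule hol[OF sep(2)])
    fix \<rho> :: real
    obtain E where "summable E"
      "\<And>n k y. cmod k \<le> \<rho> \<Longrightarrow> y \<in> {x..b} \<Longrightarrow> cmod (snd (picard q b n k y)) \<le> E n"
      by (rule picard_uniformly_summable[OF qa[of x], of \<rho>]) blast
    then show "\<exists>E. summable E \<and> (\<forall>n k. cmod k \<le> \<rho> \<longrightarrow> cmod (snd (picard q b n k x)) \<le> E n)"
      using that by auto
  qed fact

  obtain E where E: "summable E" "\<And>n x. x \<in> {a..b} \<Longrightarrow> cmod (fst (picard q b n k x)) \<le> E n"
     "\<And>n x. x \<in> {a..b} \<Longrightarrow> cmod (snd (picard q b n k x)) \<le> E n"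
    by (rule picard_uniformly_summable[OF qa[of a], of "cmod k"]) blast
  note cont = separated_entire_continuous[OF sep(1)] separated_entire_continuous[OF sep(2)]
  have cF: "continuous_on {a..b} (F k)" unfolding F_def
    by (rule uniform_limit_theorem[OF _ Weierstrass_m_test[OF E(2,1)]])
       (auto intro!: continuous_intros cont eventuallyI)
  have cG: "continuous_on {a..b} (G k)" unfolding G_def
    by (rule uniform_limit_theorem[OF _ Weierstrass_m_test[OF E(3,1)]])
       (auto intro!: continuous_intros cont eventuallyI)
  have one: "(\<lambda>t. 1 :: complex) absolutely_integrable_on {a..b}" for a
    by (intro absolutely_integrable_continuous_real continuous_intros)
  have summ: "summable (\<lambda>n. fst (picard q b n k x))" "summable (\<lambda>n. snd (picard q b n k x))"
    if "x \<in> {a..b}" for x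
    by (rule summable_comparison_test'[OF E(1)], use E that in auto)+
  \<comment> \<open>The recursion shifts the series by one term, and the term of index \<open>0\<close> is the data at \<open>b\<close>.\<close>
  have eqF: "F k x = exp (\<i> * k * b) - integral {x..b} (G k)" if x: "x \<in> {a..b}" for x
  proof -
    have "(\<lambda>n. integral {x..b} (\<lambda>t. 1 * snd (picard q b n k t))) sums integral {x..b} (\<lambda>t. 1 * G k t)"
      unfolding G_def
      by (rule sums_integral_mult_uniformly_summable[OF one cont(2) E(1)]) (use E x in auto)
    then have "(\<lambda>n. fst (picard q b (Suc n) k x)) sums (- integral {x..b} (G k))"
      by (auto intro: sums_minus)
    then have "(\<lambda>n. fst (picard q b n k x)) sums (- integral {x..b} (G k) + fst (picard q b 0 k x))"
      by (subst (asm) sums_Suc_iff) simp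
    then show ?thesis unfolding F_def by (simp add: sums_iff)
  qed
  have eqG: "G k x = \<i> * k * exp (\<i> * k * b) - integral {x..b} (\<lambda>t. (q t - k\<^sup>2) * F k t)" if x: "x \<in> {a..b}" for x
  proof -
    have "(\<lambda>n. integral {x..b} (\<lambda>t. (q t - k\<^sup>2) * fst (picard q b n k t))) sums integral {x..b} (\<lambda>t. (q t - k\<^sup>2) * F k t)"
      unfolding F_def
      by (rule sums_integral_mult_uniformly_summable[OF absolutely_integrable_complex_potential(2)[OF qa] cont(1) E(1)]) (use E x in auto)
    then have "(\<lambda>n. snd (picard q b (Suc n) k x)) sums (- integral {x..b} (\<lambda>t. (q t - k\<^sup>2) * F k t))"
      by (auto intro: sums_minus)
    then have "(\<lambda>n. snd (picard q b n k x)) sums (- integral {x..b} (\<lambda>t. (q t - k\<^sup>2) * F k t) + snd (picard q b 0 k x))"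
      by (subst (asm) sums_Suc_iff) simp
    then show ?thesis unfolding G_def by (simp add: sums_iff)
  qed
  show "primitive_on a b (G k) (F k)"
    by (rule primitive_on_right_endpoint[OF _ eqF]) (intro absolutely_integrable_continuous_real cG)
  show "primitive_on a b (\<lambda>t. (q t - k\<^sup>2) * F k t) (G k)"
    by (rule primitive_on_right_endpoint[OF _ eqG])
       (intro absolutely_integrable_continuous_times cF absolutely_integrable_complex_potential qa)
  have "fst (picard q b n k b) = 0" "snd (picard q b n k b) = 0" if "n \<notin> {0}" for n
    using that by (cases n; simp)+
  from sums_finite[of "{0}", OF _ this(1)] sums_finite[of "{0}", OF _ this(2)]
  show "F k b = exp (\<i> * k * b)" "G k b = \<i> * k * exp (\<i> * k * b)"
    unfolding F_def G_def by (simp_all add: sums_iff)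
qed

section \<open>Solutions of the Schroedinger equation\<close>

text \<open>The equation as a first order system for the pair \<open>(f, f')\<close>. Naming the derivative makes the Cauchy
  data at a point available without derivatives at interval endpoints.\<close>

definition solves_on ::
  "real \<Rightarrow> real \<Rightarrow> (real \<Rightarrow> real) \<Rightarrow> complex \<Rightarrow> (real \<Rightarrow> complex) \<Rightarrow> (real \<Rightarrow> complex) \<Rightarrow> bool" where
  "solves_on a b q k f g \<longleftrightarrow> primitive_on a b g f \<and> primitive_on a b (\<lambda>t. (q t - k\<^sup>2) * f t) g"

lemma solves_on_exp:
  "solves_on a b (\<lambda>_. 0) k (\<lambda>x. exp (\<i> * k * x)) (\<lambda>x. \<i> * k * exp (\<i> * k * x))"
proof -
  have d: "((\<lambda>x. c * exp (\<i> * k * x)) has_vector_derivative c * (\<i> * k * exp (\<i> * k * x))) (at x within S)"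
    for c x and S :: "real set"
    by (rule has_vector_derivative_real_field) (auto intro!: derivative_eq_intros simp: mult_ac)
  have "primitive_on a b (\<lambda>x. 1 * (\<i> * k * exp (\<i> * k * x))) (\<lambda>x. 1 * exp (\<i> * k * x))"
    by (intro primitive_on_C1 d continuous_intros)
  moreover have "primitive_on a b (\<lambda>x. \<i> * k * (\<i> * k * exp (\<i> * k * x))) (\<lambda>x. \<i> * k * exp (\<i> * k * x))"
    by (intro primitive_on_C1 d continuous_intros)
  moreover have "\<i> * k * (\<i> * k * z) = (complex_of_real 0 - k\<^sup>2) * z" for z
  proof -
    have "\<i> * k * (\<i> * k * z) = (\<i> * \<i>) * k\<^sup>2 * z" by (simp only: power2_eq_square mult_ac)
    then show ?thesis by simp
  qed
  ultimately show ?thesis by (simp add: solves_on_def)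
qed

lemma solves_on_spike:
  assumes "solves_on a b q k f g" "negligible N" "\<And>t. t \<in> {a..b} - N \<Longrightarrow> q' t = q t"
    and "\<And>x. x \<in> {a..b} \<Longrightarrow> f' x = f x \<and> g' x = g x"
  shows "solves_on a b q' k f' g'"
  unfolding solves_on_def
proof
  show "primitive_on a b g' f'"
    by (rule primitive_on_spike[of _ _ g f "{}"]) (use assms in \<open>auto simp: solves_on_def\<close>)
  show "primitive_on a b (\<lambda>t. (q' t - k\<^sup>2) * f' t) g'"
    by (rule primitive_on_spike[of _ _ "\<lambda>t. (q t - k\<^sup>2) * f t" g N]) (use assms in \<open>auto simp: solves_on_def\<close>)
qed

lemma solves_on_combine:
  "solves_on a b q k f g \<Longrightarrow> solves_on b c q k f g \<Longrightarrow> a \<le> b \<Longrightarrow> b \<le> c \<Longrightarrow> solves_on a c q k f g"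
  by (auto simp: solves_on_def intro: primitive_on_combine)

lemma solves_on_subset:
  "solves_on a b q k f g \<Longrightarrow> a \<le> a' \<Longrightarrow> b' \<le> b \<Longrightarrow> solves_on a' b' q k f g"
  by (auto simp: solves_on_def intro: primitive_on_subset)

lemma solves_on_reflect:
  assumes "solves_on a b q k f g"
  shows "solves_on (- b) (- a) (\<lambda>t. q (- t)) k (\<lambda>x. f (- x)) (\<lambda>x. - g (- x))"
proof -
  have "primitive_on (- b) (- a) (\<lambda>t. - g (- t)) (\<lambda>x. f (- x))"
    using assms by (intro primitive_on_reflect) (auto simp: solves_on_def)
  moreover have "primitive_on (- b) (- a) (\<lambda>t. - (- ((q (- t) - k\<^sup>2) * f (- t)))) (\<lambda>x. - g (- x))"
    using assms
    by (intro primitive_on_uminus primitive_on_reflect[of a b "\<lambda>t. (q t - k\<^sup>2) * f t"]) (auto simp: solves_on_def)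
  ultimately show ?thesis by (simp add: solves_on_def)
qed

text \<open>Uniqueness for the Cauchy problem, by Gronwall's inequality with constant \<open>0\<close> for \<open>\<bar>f\<bar> + \<bar>g\<bar>\<close>.\<close>

lemma solves_on_zero:
  assumes s: "solves_on a b q k f g" and q: "q absolutely_integrable_on {a..b}"
    and b: "f b = 0" "g b = 0" and x: "x \<in> {a..b}"
  shows "f x = 0 \<and> g x = 0"
proof -
  have pf: "primitive_on a b g f" and pg: "primitive_on a b (\<lambda>t. (q t - k\<^sup>2) * f t) g"
    using s by (auto simp: solves_on_def)
  note cf = primitive_on_continuous[OF pf] and cg = primitive_on_continuous[OF pg]
  let ?p = "\<lambda>t. \<bar>q t\<bar> + (1 + (cmod k)\<^sup>2)" and ?u = "\<lambda>x. cmod (f x) + cmod (g x)"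
  have p: "?p absolutely_integrable_on {a..b}"
    by (intro set_integral_add(1) absolutely_integrable_norm[OF q, unfolded o_def real_norm_def]
        absolutely_integrable_continuous_real[OF continuous_on_const])
  have u: "continuous_on {a..b} ?u" by (intro continuous_intros cf cg)
  have le: "?u x \<le> 0 + integral {x..b} (\<lambda>t. ?p t * ?u t)" if x: "x \<in> {a..b}" for x
  proof -
    have i: "(\<lambda>t. ?p t * ?u t) integrable_on {x..b}"
      using absolutely_integrable_continuous_times(2)[OF u p] x
      by (auto simp: absolutely_integrable_on_def intro: integrable_subinterval_real)
    have sm: "(\<lambda>t. norm (g t) + norm ((q t - k\<^sup>2) * f t)) integrable_on {x..b}"
    proof -
      have "(\<lambda>t. norm (g t) + norm ((q t - k\<^sup>2) * f t)) integrable_on {a..b}"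
        using primitive_on_absolutely_integrable[OF pf] primitive_on_absolutely_integrable[OF pg]
        by (intro integrable_add) (auto simp: absolutely_integrable_on_def)
      then show ?thesis using x by (auto intro: integrable_subinterval_real)
    qed
    have bnd: "norm (integral {x..b} h) \<le> integral {x..b} (\<lambda>t. norm (h t))"
      if "h absolutely_integrable_on {a..b}" for h :: "real \<Rightarrow> complex"
      using that x by (intro Henstock_Kurzweil_Integration.integral_norm_bound_integral)
        (auto simp: absolutely_integrable_on_def intro: integrable_subinterval_real)
    have ints: "(\<lambda>t. norm (h t)) integrable_on {x..b}" if "h absolutely_integrable_on {a..b}" for h :: "real \<Rightarrow> complex"
      using that x by (auto simp: absolutely_integrable_on_def intro: integrable_subinterval_real)
    have "f x = - integral {x..b} g"
      using integral_unique[OF primitive_onD[OF pf, of x b]] x b by simp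
    then have 1: "cmod (f x) \<le> integral {x..b} (\<lambda>t. norm (g t))"
      using bnd[OF primitive_on_absolutely_integrable[OF pf]] by simp
    have "g x = - integral {x..b} (\<lambda>t. (q t - k\<^sup>2) * f t)"
      using integral_unique[OF primitive_onD[OF pg, of x b]] x b by simp
    then have 2: "cmod (g x) \<le> integral {x..b} (\<lambda>t. norm ((q t - k\<^sup>2) * f t))"
      using bnd[OF primitive_on_absolutely_integrable[OF pg]] by simp
    have "?u x \<le> integral {x..b} (\<lambda>t. norm (g t)) + integral {x..b} (\<lambda>t. norm ((q t - k\<^sup>2) * f t))"
      using 1 2 by simp
    also have "\<dots> = integral {x..b} (\<lambda>t. norm (g t) + norm ((q t - k\<^sup>2) * f t))"
      by (rule Henstock_Kurzweil_Integration.integral_add[symmetric])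
        (rule ints primitive_on_absolutely_integrable[OF pf] primitive_on_absolutely_integrable[OF pg])+
    also have "\<dots> \<le> integral {x..b} (\<lambda>t. ?p t * ?u t)"
    proof (rule integral_le[OF sm i])
      fix t
      have "norm ((q t - k\<^sup>2) * f t) \<le> (\<bar>q t\<bar> + (cmod k)\<^sup>2) * cmod (f t)"
        unfolding norm_mult by (intro mult_right_mono) (metis norm_of_real norm_power norm_triangle_ineq4, simp)
      moreover have "0 \<le> (\<bar>q t\<bar> + (cmod k)\<^sup>2) * cmod (g t)" "0 \<le> cmod (f t)" by simp_all
      moreover have "?p t * ?u t = (\<bar>q t\<bar> + (cmod k)\<^sup>2) * cmod (f t) + (\<bar>q t\<bar> + (cmod k)\<^sup>2) * cmod (g t)
          + cmod (f t) + cmod (g t)" by (simp add: algebra_simps)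
      ultimately show "norm (g t) + norm ((q t - k\<^sup>2) * f t) \<le> ?p t * ?u t" by linarith
    qed
    finally show ?thesis by simp
  qed
  have "?u x \<le> 0 * exp (integral {x..b} ?p)"
    by (rule gronwall_integrable_kernel[OF p _ u le x]) auto
  then have "?u x \<le> 0" by simp
  then show ?thesis using norm_ge_zero[of "f x"] norm_ge_zero[of "g x"] by (metis add_nonneg_eq_0_iff antisym add_nonneg_nonneg norm_eq_zero)
qed

lemma solves_on_unique:
  assumes "solves_on a b q k f g" "solves_on a b q k f' g'" "q absolutely_integrable_on {a..b}"
    and "f b = f' b" "g b = g' b" "x \<in> {a..b}"
  shows "f x = f' x \<and> g x = g' x"
proof -
  have "solves_on a b q k (\<lambda>x. f x - f' x) (\<lambda>x. g x - g' x)"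
    using assms(1,2) primitive_on_diff[of a b g f g' f']
      primitive_on_diff[of a b "\<lambda>t. (q t - k\<^sup>2) * f t" g "\<lambda>t. (q t - k\<^sup>2) * f' t" g']
    by (auto simp: solves_on_def algebra_simps)
  from solves_on_zero[OF this assms(3)] show ?thesis using assms by auto
qed

text \<open>To the right of \<open>b\<close> the potential vanishes almost everywhere and the plane wave is the solution;
  Picard's solution with matching data at \<open>b\<close> continues it to the left.\<close>

lemma jost_family_exists:
  fixes q :: "real \<Rightarrow> real" and b :: real
  assumes q: "\<And>a. q absolutely_integrable_on {a..b}" and N: "negligible {t. b < t \<and> q t \<noteq> 0}"
  obtains F G :: "complex \<Rightarrow> real \<Rightarrow> complex" where
    "\<And>x. (\<lambda>k. F k x) holomorphic_on UNIV" "\<And>x. (\<lambda>k. G k x) holomorphic_on UNIV"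
    "\<And>k x. b \<le> x \<Longrightarrow> F k x = exp (\<i> * k * x)" "\<And>k x. b \<le> x \<Longrightarrow> G k x = \<i> * k * exp (\<i> * k * x)"
    "\<And>a c k. solves_on a c q k (F k) (G k)"
proof -
  define F0 where "F0 k x = (\<Sum>n. fst (picard q b n k x))" for k x
  define G0 where "G0 k x = (\<Sum>n. snd (picard q b n k x))" for k x
  note P = picard_solution[OF q, folded F0_def G0_def]
  define F where "F k x = (if x \<le> b then F0 k x else exp (\<i> * k * x))" for k x
  define G where "G k x = (if x \<le> b then G0 k x else \<i> * k * exp (\<i> * k * x))" for k x
  show ?thesis
  proof
    fix x
    show "(\<lambda>k. F k x) holomorphic_on UNIV"
      by (cases "x \<le> b") (auto simp: F_def intro!: P(1) holomorphic_intros)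
    show "(\<lambda>k. G k x) holomorphic_on UNIV"
      by (cases "x \<le> b") (auto simp: G_def intro!: P(2) holomorphic_intros)
  next
    fix k x assume "b \<le> x"
    then show "F k x = exp (\<i> * k * x)" "G k x = \<i> * k * exp (\<i> * k * x)"
      using P(3,4) by (auto simp: F_def G_def)
  next
    fix a c k
    have L: "solves_on (min a b) b q k (F k) (G k)"
    proof (rule solves_on_spike[where N = "{}"])
      show "solves_on (min a b) b q k (F0 k) (G0 k)" using P(5,6) by (simp add: solves_on_def)
    qed (auto simp: F_def G_def)
    have "solves_on b (max b c) q k (F k) (G k)"
    proof (rule solves_on_spike[OF solves_on_exp N[THEN negligible_insert[THEN iffD2, of _ b]]])
      show "q t = 0" if "t \<in> {b..max b c} - insert b {t. b < t \<and> q t \<noteq> 0}" for t using that by auto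
      show "F k x = exp (\<i> * k * x) \<and> G k x = \<i> * k * exp (\<i> * k * x)" if "x \<in> {b..max b c}" for x
        using that P(3,4) by (auto simp: F_def G_def)
    qed
    from solves_on_combine[OF L this] have "solves_on (min a b) (max b c) q k (F k) (G k)" by simp
    then show "solves_on a c q k (F k) (G k)" by (rule solves_on_subset) auto
  qed
qed

text \<open>Derivatives within the line or the closed half-line can be taken within a compact interval,
  one-sided only at the endpoint of the half-line.\<close>

lemma at_within_right_ray:
  assumes "I = UNIV \<or> I = {0..}" "x \<in> (I :: real set)"
  obtains a c where "a \<in> I" "x \<in> {a..c}" "{a..c} \<subseteq> I" "at x within {a..c} = at x within I"
proof (cases "I = UNIV")
  case True
  have "at x within {x-1..x+1} = at x within UNIV"
    by (rule at_within_nhd[where S = "{x-1<..<x+1}"]) auto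
  then show ?thesis using True by (intro that[of "x - 1" "x + 1"]) auto
next
  case False
  with assms have I: "I = {0..}" "0 \<le> x" by auto
  have "at x within {0..x+1} = at x within {0..}"
    by (rule at_within_nhd[where S = "{x-1<..<x+1}"]) auto
  then show ?thesis using I by (intro that[of 0 "x + 1"]) auto
qed

lemma schroedinger_solution_if_solves_on:
  assumes I: "I = UNIV \<or> I = {0..}" and s: "\<And>a c. a \<in> I \<Longrightarrow> solves_on a c q k f g"
  shows "schroedinger_solution I q k f"
    and "x \<in> I \<Longrightarrow> (f has_vector_derivative g x) (at x within I)"
proof -
  show *: "(f has_vector_derivative g x) (at x within I)" if x: "x \<in> I" for x
  proof -
    obtain a c where a: "a \<in> I" "x \<in> {a..c}" "at x within {a..c} = at x within I"
      using at_within_right_ray[OF I x] by metis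
    have "primitive_on a c g f" "primitive_on a c (\<lambda>t. (q t - k\<^sup>2) * f t) g"
      using s[OF a(1)] by (auto simp: solves_on_def)
    then show ?thesis
      using primitive_on_has_vector_derivative[of a c g f x] primitive_on_continuous a by metis
  qed
  show "schroedinger_solution I q k f"
    unfolding schroedinger_solution_def
  proof (intro exI[of _ g] conjI ballI impI *)
    fix a b assume "a \<in> I" "b \<in> I" "a \<le> b"
    then show "((\<lambda>t. (complex_of_real (q t) - k\<^sup>2) * f t) has_integral g b - g a) {a..b}"
      using s[of a b] primitive_onD[of a b "\<lambda>t. (q t - k\<^sup>2) * f t" g a b] by (auto simp: solves_on_def)
  qed
qed

lemma schroedinger_solution_solves_on:
  assumes I: "I = UNIV \<or> I = {0..}" and q: "\<And>a c. a \<in> I \<Longrightarrow> q absolutely_integrable_on {a..c}"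
    and s: "schroedinger_solution I q k f"
  obtains g where "\<And>x. x \<in> I \<Longrightarrow> (f has_vector_derivative g x) (at x within I)"
    "\<And>a c. a \<in> I \<Longrightarrow> solves_on a c q k f g"
proof -
  obtain g where d: "\<And>x. x \<in> I \<Longrightarrow> (f has_vector_derivative g x) (at x within I)"
    and h: "\<And>a b. a \<in> I \<Longrightarrow> b \<in> I \<Longrightarrow> a \<le> b \<Longrightarrow>
       ((\<lambda>t. (complex_of_real (q t) - k\<^sup>2) * f t) has_integral (g b - g a)) {a..b}"
    using s unfolding schroedinger_solution_def by blast
  have "solves_on a c q k f g" if a: "a \<in> I" for a c
  proof -
    have sub: "{a..c} \<subseteq> I" using I a by auto
    have d': "(f has_vector_derivative g x) (at x within {a..c})" if "x \<in> {a..c}" for x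
      using that sub by (intro has_vector_derivative_within_subset[OF d]) auto
    have cf: "continuous_on {a..c} f"
      unfolding continuous_on_eq_continuous_within
      using d' has_vector_derivative_continuous by blast
    have 2: "primitive_on a c (\<lambda>t. (q t - k\<^sup>2) * f t) g"
      unfolding primitive_on_def
    proof (intro conjI allI impI)
      show "(\<lambda>t. (q t - k\<^sup>2) * f t) absolutely_integrable_on {a..c}"
        by (intro absolutely_integrable_continuous_times cf absolutely_integrable_complex_potential q a)
      show "((\<lambda>t. (q t - k\<^sup>2) * f t) has_integral g y - g x) {x..y}" if "a \<le> x" "x \<le> y" "y \<le> c" for x y
        using that sub by (intro h) (auto simp: subset_iff)
    qed
    moreover have "primitive_on a c g f"
      by (intro primitive_on_C1 primitive_on_continuous[OF 2] d')
    ultimately show ?thesis by (simp add: solves_on_def)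
  qed
  then show ?thesis using that d by blast
qed

text \<open>Solutions that agree near \<open>+\<infinity>\<close> have the same Cauchy data at some interior point \<open>b\<close>, to the right of
  the given one.\<close>

lemma schroedinger_solution_unique:
  assumes I: "I = UNIV \<or> I = {0..}" and q: "\<And>a c. a \<in> I \<Longrightarrow> q absolutely_integrable_on {a..c}"
    and s: "schroedinger_solution I q k f" and s': "schroedinger_solution I q k f'"
    and ev: "\<forall>\<^sub>F x in at_top. f x = f' x" and x: "x \<in> I"
  shows "f x = f' x"
proof -
  obtain g where g: "\<And>x. x \<in> I \<Longrightarrow> (f has_vector_derivative g x) (at x within I)"
    "\<And>a c. a \<in> I \<Longrightarrow> solves_on a c q k f g"
    by (rule schroedinger_solution_solves_on[OF I q s]) blast+
  obtain g' where g': "\<And>x. x \<in> I \<Longrightarrow> (f' has_vector_derivative g' x) (at x within I)"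
    "\<And>a c. a \<in> I \<Longrightarrow> solves_on a c q k f' g'"
    by (rule schroedinger_solution_solves_on[OF I q s']) blast+
  obtain X where X: "\<And>y. y \<ge> X \<Longrightarrow> f y = f' y" using ev by (auto simp: eventually_at_top_linorder)
  define b where "b = max x (max X 0) + 1"
  have b: "b > X" "b > 0" "x \<le> b" "b \<in> I" using I by (auto simp: b_def)
  have nb: "at b within I = at b"
  proof (rule at_within_interior)
    show "b \<in> interior I" using I b by (auto simp: interior_Ici[of _ "-1::real"] interior_open)
  qed
  have "(f has_vector_derivative g b) (at b)" "(f' has_vector_derivative g' b) (at b)"
    using g(1)[of b] g'(1)[of b] b nb by auto
  moreover have "(f has_vector_derivative g' b) (at b)"
    by (rule has_vector_derivative_transform_within_open[OF \<open>(f' has_vector_derivative g' b) (at b)\<close>, of "{X<..}"])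
       (use X b in auto)
  ultimately have "g b = g' b" by (metis vector_derivative_at)
  moreover have "f b = f' b" using X b by auto
  ultimately show ?thesis
    using solves_on_unique[OF g(2)[OF x] g'(2)[OF x] q[OF x], of b x] b by auto
qed

section \<open>Jost solutions and their Wronskian\<close>

text \<open>The choice operator in the definition of the Jost solution is resolved by uniqueness. At \<open>k = 0\<close> the
  limit that defines the value is that of the continuous function \<open>F \<cdot> x\<close>.\<close>

lemma jost_plus_eq:
  fixes F G :: "complex \<Rightarrow> real \<Rightarrow> complex"
  assumes I: "I = UNIV \<or> I = {0..}" and q: "\<And>a c. a \<in> I \<Longrightarrow> q absolutely_integrable_on {a..c}"
    and hol: "\<And>x. (\<lambda>k. F k x) holomorphic_on UNIV"
    and F: "\<And>k x. b \<le> x \<Longrightarrow> F k x = exp (\<i> * k * x)"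
    and s: "\<And>a c k. a \<in> I \<Longrightarrow> solves_on a c q k (F k) (G k)"
    and x: "x \<in> I"
  shows "jost_plus I q x k = F k x" and "jost_plus_deriv I q x k = G k x"
proof -
  have ss: "schroedinger_solution I q k (F k)" for k
    by (rule schroedinger_solution_if_solves_on[OF I s])
  have ev: "\<forall>\<^sub>F x in at_top. F k x = exp (\<i> * k * x)" for k
    using F by (auto simp: eventually_at_top_linorder)
  have sol: "jost_plus_solution I q k x = F k x" if x: "x \<in> I" for k x
  proof -
    define f where "f = jost_plus_solution I q k"
    have *: "schroedinger_solution I q k f \<and> (\<forall>\<^sub>F x in at_top. f x = exp (\<i> * k * complex_of_real x))"
      unfolding f_def jost_plus_solution_def by (rule someI[of _ "F k"]) (use ss ev in auto)
    have "\<forall>\<^sub>F x in at_top. f x = F k x"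
      using *[THEN conjunct2] ev[of k] by eventually_elim simp
    then have "f x = F k x" using * by (intro schroedinger_solution_unique[OF I q _ ss _ x]) auto
    then show ?thesis by (simp add: f_def)
  qed
  have eq: "jost_plus I q y k = F k y" if y: "y \<in> I" for k y
  proof (cases "k = 0")
    case True
    have "isCont (\<lambda>k. F k y) 0"
      using holomorphic_on_imp_continuous_on[OF hol[of y]] by (simp add: continuous_on_eq_continuous_at)
    then have "((\<lambda>k. jost_plus_solution I q k y) \<longlongrightarrow> F 0 y) (at 0)"
      by (simp add: sol[OF y] isCont_def)
    then show ?thesis using True by (simp add: jost_plus_def tendsto_Lim)
  qed (simp add: jost_plus_def sol[OF y])
  then show "jost_plus I q x k = F k x" using x by auto
  have "(F k has_vector_derivative G k x) (at x within I)"
    by (rule schroedinger_solution_if_solves_on(2)[OF I s x])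
  then have "((\<lambda>y. jost_plus I q y k) has_vector_derivative G k x) (at x within I)"
    by (rule has_vector_derivative_transform[OF x, rotated]) (use eq in auto)
  moreover have "at x within I \<noteq> bot"
  proof
    assume "at x within I = bot"
    moreover have "at_right x \<le> at x within I" using I x by (intro at_le) auto
    ultimately show False using trivial_limit_at_right_real[of x] by (simp add: bot_unique)
  qed
  ultimately show "jost_plus_deriv I q x k = G k x"
    unfolding jost_plus_deriv_def by (rule vector_derivative_within[rotated])
qed

text \<open>Reflection \<open>x \<mapsto> - x\<close> exchanges the two ends of the line, so uniqueness near \<open>-\<infinity>\<close> follows from
  uniqueness near \<open>+\<infinity>\<close>.\<close>

lemma jost_minus_eq:
  fixes F G :: "complex \<Rightarrow> real \<Rightarrow> complex"
  assumes qa: "\<And>a c. q absolutely_integrable_on {a..c}"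
    and hol: "\<And>x. (\<lambda>k. F k x) holomorphic_on UNIV"
    and F: "\<And>k x. x \<le> b \<Longrightarrow> F k x = exp (- \<i> * k * x)"
    and s: "\<And>a c k. solves_on a c q k (F k) (G k)"
  shows "jost_minus q x k = F k x" and "jost_minus_deriv q x k = G k x"
proof -
  define q' where "q' t = q (- t)" for t
  have qa': "q' absolutely_integrable_on {a..c}" for a c
    unfolding q'_def[abs_def] using qa[of "-c" "-a"]
    by (subst absolutely_integrable_reflect_real[symmetric]) simp
  have ss: "schroedinger_solution UNIV q k (F k)" for k
    by (rule schroedinger_solution_if_solves_on) (use s in auto)
  have ev: "\<forall>\<^sub>F x in at_bot. F k x = exp (- \<i> * k * x)" for k
    using F by (auto simp: eventually_at_bot_linorder)
  have reflect: "schroedinger_solution UNIV q' k (\<lambda>x. f (- x))" if sol: "schroedinger_solution UNIV q k f" for f k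
  proof -
    obtain g where "\<And>a c. solves_on a c q k f g"
      by (rule schroedinger_solution_solves_on[OF _ qa sol]) auto
    then have "solves_on a c q' k (\<lambda>x. f (- x)) (\<lambda>x. - g (- x))" for a c
      using solves_on_reflect[of "-c" "-a" q k f g] by (simp add: q'_def[abs_def])
    then show ?thesis by (intro schroedinger_solution_if_solves_on) auto
  qed
  have sol: "jost_minus_solution q k x = F k x" for k x
  proof -
    define f where "f = jost_minus_solution q k"
    have *: "schroedinger_solution UNIV q k f \<and> (\<forall>\<^sub>F x in at_bot. f x = exp (- \<i> * k * complex_of_real x))"
      unfolding f_def jost_minus_solution_def by (rule someI[of _ "F k"]) (use ss ev in auto)
    have "\<forall>\<^sub>F x in at_bot. f x = F k x"
      using *[THEN conjunct2] ev[of k] by eventually_elim simp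
    then have "\<forall>\<^sub>F x in at_top. f (- x) = F k (- x)" by (simp add: at_bot_mirror eventually_filtermap)
    then have "f (- (- x)) = F k (- (- x))" using *
      by (intro schroedinger_solution_unique[where I = UNIV, OF _ qa' reflect reflect[OF ss]]) auto
    then show ?thesis by (simp add: f_def)
  qed
  have eq: "jost_minus q y k = F k y" for k y
  proof (cases "k = 0")
    case True
    have "isCont (\<lambda>k. F k y) 0"
      using holomorphic_on_imp_continuous_on[OF hol[of y]] by (simp add: continuous_on_eq_continuous_at)
    then have "((\<lambda>k. jost_minus_solution q k y) \<longlongrightarrow> F 0 y) (at 0)"
      by (simp add: sol isCont_def)
    then show ?thesis using True by (simp add: jost_minus_def tendsto_Lim)
  qed (simp add: jost_minus_def sol)
  then show "jost_minus q x k = F k x" .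
  have "(F k has_vector_derivative G k x) (at x within UNIV)"
    by (rule schroedinger_solution_if_solves_on(2)[OF _ s]) auto
  then show "jost_minus_deriv q x k = G k x"
    unfolding jost_minus_deriv_def eq by (simp add: vector_derivative_at)
qed

text \<open>The Wronskian does not depend on \<open>x\<close> by the product rule, and at \<open>x = 0\<close> the solution \<open>\<psi>\<^sub>-\<close> and its
  derivative take the values \<open>1\<close> and \<open>- ik\<close> of the plane wave.\<close>

lemma jost_wronskian_eq:
  fixes F G :: "complex \<Rightarrow> real \<Rightarrow> complex"
  assumes qa: "\<And>a c. q absolutely_integrable_on {a..c}"
    and N: "negligible {t. t < 0 \<and> q t \<noteq> 0}"
    and hol: "\<And>x. (\<lambda>k. F k x) holomorphic_on UNIV"
    and F: "\<And>k x. b \<le> x \<Longrightarrow> F k x = exp (\<i> * k * x)"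
    and s: "\<And>a c k. solves_on a c q k (F k) (G k)"
  shows "jost_wronskian q x k = G k 0 + \<i> * k * F k 0"
proof -
  have q': "(\<lambda>t. q (- t)) absolutely_integrable_on {a..c}" for a c
    using qa[of "-c" "-a"] by (subst absolutely_integrable_reflect_real[symmetric]) simp
  have N': "negligible {t. 0 < t \<and> q (- t) \<noteq> 0}"
  proof -
    have "negligible (uminus ` {t. t < 0 \<and> q t \<noteq> 0})"
      by (rule negligible_differentiable_image_negligible[OF _ N]) (auto intro!: derivative_intros)
    moreover have "uminus ` {t. t < 0 \<and> q t \<noteq> 0} = {t. 0 < t \<and> q (- t) \<noteq> 0}"
      by (auto intro!: image_eqI[of _ uminus "- x" for x])
    ultimately show ?thesis by simp
  qed
  obtain A B :: "complex \<Rightarrow> real \<Rightarrow> complex" where A: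
    "\<And>x. (\<lambda>k. A k x) holomorphic_on UNIV" "\<And>x. (\<lambda>k. B k x) holomorphic_on UNIV"
    "\<And>k x. 0 \<le> x \<Longrightarrow> A k x = exp (\<i> * k * x)" "\<And>k x. 0 \<le> x \<Longrightarrow> B k x = \<i> * k * exp (\<i> * k * x)"
    "\<And>a c k. solves_on a c (\<lambda>t. q (- t)) k (A k) (B k)"
    by (rule jost_family_exists[OF q' N']) blast
  have sm: "solves_on a c q k (\<lambda>x. A k (- x)) (\<lambda>x. - B k (- x))" for a c k
    using solves_on_reflect[OF A(5)[of "-c" "-a" k]] by simp
  have m: "jost_minus q x k = A k (- x)" "jost_minus_deriv q x k = - B k (- x)"
    by (rule jost_minus_eq[OF qa, of "\<lambda>k x. A k (- x)" 0 "\<lambda>k x. - B k (- x)"],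
        use A(1,3) sm in auto)+
  have p: "jost_plus UNIV q x k = F k x" "jost_plus_deriv UNIV q x k = G k x"
    by (rule jost_plus_eq[OF _ qa hol F s]; simp)+
  define W where "W x = A k (- x) * G k x - (- B k (- x)) * F k x" for x
  define a c where "a = min 0 x" and "c = max 0 x"
  have sF: "primitive_on a c (G k) (F k)" "primitive_on a c (\<lambda>t. (q t - k\<^sup>2) * F k t) (G k)"
    and sA: "primitive_on a c (\<lambda>x. - B k (- x)) (\<lambda>x. A k (- x))" "primitive_on a c (\<lambda>t. (q t - k\<^sup>2) * A k (- t)) (\<lambda>x. - B k (- x))"
    using s[of a c k] sm[of a c k] by (auto simp: solves_on_def)
  have "primitive_on a c (\<lambda>t. 0) W"
    using primitive_on_diff[OF primitive_on_mult[OF sA(1) sF(2)] primitive_on_mult[OF sA(2) sF(1)]]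
    unfolding W_def by (simp add: algebra_simps)
  from primitive_onD[OF this, of a c] have "W c = W a"
    using has_integral_unique[OF has_integral_0] by (fastforce simp: a_def c_def)
  then have "W x = W 0" by (auto simp: a_def c_def min_def max_def split: if_splits)
  also have "W 0 = G k 0 + \<i> * k * F k 0" using A(3,4)[of 0 k] by (simp add: W_def)
  finally show ?thesis by (simp add: jost_wronskian_def m p W_def)
qed

section \<open>Growth and conserved flux of the Jost solution\<close>

lemma primitive_on_plane_wave:
  "primitive_on a b (\<lambda>x. \<i> * k * exp (\<i> * k * x)) (\<lambda>x. exp (\<i> * k * complex_of_real x))"
  using solves_on_exp[of a b k] by (simp add: solves_on_def)

text \<open>Variation of constants: with \<open>2ik f = A e\<^sup>i\<^sup>k\<^sup>x + B e\<^sup>-\<^sup>i\<^sup>k\<^sup>x\<close> and \<open>2g = A e\<^sup>i\<^sup>k\<^sup>x - B e\<^sup>-\<^sup>i\<^sup>k\<^sup>x\<close> one has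
  \<open>A' = e\<^sup>-\<^sup>i\<^sup>k\<^sup>x q f\<close> and \<open>B' = - e\<^sup>i\<^sup>k\<^sup>x q f\<close>, with \<open>A = 2ik\<close> and \<open>B = 0\<close> at \<open>b\<close>. Treating \<open>f\<close> and \<open>g / k\<close>
  together in this way gives both bounds with the same constant.\<close>

lemma solves_on_modulus_bound:
  fixes k :: complex and b :: real
  assumes s: "solves_on 0 b q k f g" and q: "q absolutely_integrable_on {0..b}" and b: "0 \<le> b"
    and k: "k \<noteq> 0" and fb: "f b = exp (\<i> * k * b)" "g b = \<i> * k * exp (\<i> * k * b)"
  defines "E \<equiv> exp (2 * b * max 0 (- Im k) + integral {0..b} (\<lambda>t. \<bar>q t\<bar>) / cmod k)"
  shows "cmod (f 0) \<le> E" and "cmod (g 0) \<le> cmod k * E"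
proof -
  define \<eta> \<kappa> where "\<eta> = Im k" and "\<kappa> = max 0 (- Im k)"
  have \<kappa>: "0 \<le> \<kappa>" "0 \<le> \<eta> + \<kappa>" by (auto simp: \<eta>_def \<kappa>_def)
  have pf: "primitive_on 0 b g f" and pg: "primitive_on 0 b (\<lambda>t. (q t - k\<^sup>2) * f t) g"
    using s by (auto simp: solves_on_def)
  note cf = primitive_on_continuous[OF pf] and cg = primitive_on_continuous[OF pg]
  define A B where "A x = exp (\<i> * (- k) * complex_of_real x) * (\<i> * k * f x + g x)"
    and "B x = exp (\<i> * k * complex_of_real x) * (\<i> * k * f x - g x)" for x
  have pA: "primitive_on 0 b (\<lambda>t. exp (\<i> * (- k) * t) * (q t * f t)) A"
    unfolding A_def
    by (rule primitive_on_spike[OF primitive_on_mult[OF primitive_on_plane_wave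
          primitive_on_add[OF primitive_on_cmult[OF pf, of "\<i> * k"] pg], of "- k"] negligible_empty])
      (auto simp: power2_eq_square algebra_simps)
  have pB: "primitive_on 0 b (\<lambda>t. - (exp (\<i> * k * t) * (q t * f t))) B"
    unfolding B_def
    by (rule primitive_on_spike[OF primitive_on_mult[OF primitive_on_plane_wave
          primitive_on_diff[OF primitive_on_cmult[OF pf, of "\<i> * k"] pg], of k] negligible_empty])
      (auto simp: power2_eq_square algebra_simps)
  have ee: "exp (\<i> * k * x) * exp (\<i> * (- k) * x) = 1" for x :: real
    by (simp flip: exp_add)
  have ne: "cmod (exp (\<i> * k * x)) = exp (- \<eta> * x)" "cmod (exp (\<i> * (- k) * x)) = exp (\<eta> * x)" for x :: real
    by (simp_all add: \<eta>_def)
  have fAB: "2 * \<i> * k * f x = A x * exp (\<i> * k * x) + B x * exp (\<i> * (- k) * x)" for x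
    using ee[of x] unfolding A_def B_def by algebra
  have gAB: "2 * g x = A x * exp (\<i> * k * x) - B x * exp (\<i> * (- k) * x)" for x
    using ee[of x] unfolding A_def B_def by algebra
  \<comment> \<open>The weight \<open>W\<close> cancels the free growth of \<open>f\<close>: the decaying \<open>e\<^sup>i\<^sup>k\<^sup>x\<close> in the upper half-plane, and a wave
    that travels to \<open>b\<close> and back in the lower one. The factors in \<open>u\<close> are \<open>W\<close> times those of the two waves.\<close>
  define W where "W x = exp (\<eta> * x - 2 * \<kappa> * (b - x))" for x
  define u where "u x = (cmod (A x) * exp (- 2 * \<kappa> * (b - x)) + cmod (B x) * exp (2 * (\<eta> + \<kappa>) * x - 2 * \<kappa> * b)) / (2 * cmod k)" for x
  have kk: "cmod k > 0" using k by simp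
  have tri: "cmod (A x * exp (\<i> * k * x)) * W x + cmod (B x * exp (\<i> * (- k) * x)) * W x = 2 * cmod k * u x" for x
  proof -
    have "exp (- \<eta> * x) * W x = exp (- 2 * \<kappa> * (b - x))"
         "exp (\<eta> * x) * W x = exp (2 * (\<eta> + \<kappa>) * x - 2 * \<kappa> * b)"
      unfolding W_def exp_add[symmetric] by (simp_all add: algebra_simps)
    moreover have "cmod (A x * exp (\<i> * k * x)) = cmod (A x) * exp (- \<eta> * x)"
        "cmod (B x * exp (\<i> * (- k) * x)) = cmod (B x) * exp (\<eta> * x)"
      by (simp_all only: norm_mult[of "A x"] norm_mult[of "B x"] ne)
    moreover have "2 * cmod k * u x = cmod (A x) * exp (- 2 * \<kappa> * (b - x)) + cmod (B x) * exp (2 * (\<eta> + \<kappa>) * x - 2 * \<kappa> * b)"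
      using kk by (simp add: u_def)
    ultimately show ?thesis by (simp only: mult.assoc)
  qed
  have W0: "W x > 0" for x by (simp add: W_def)
  have fu: "cmod (f x) * W x \<le> u x" for x
  proof -
    have "2 * cmod k * cmod (f x) = cmod (2 * \<i> * k * f x)" by (simp add: norm_mult)
    also have "\<dots> \<le> cmod (A x * exp (\<i> * k * x)) + cmod (B x * exp (\<i> * (- k) * x))"
      unfolding fAB by (rule norm_triangle_ineq)
    finally have "2 * cmod k * cmod (f x) * W x \<le> 2 * cmod k * u x"
      unfolding tri[symmetric] distrib_right[symmetric] by (intro mult_right_mono) (use W0[of x] in auto)
    then show ?thesis using kk by simp
  qed
  have gu: "cmod (g x) * W x \<le> cmod k * u x" for x
  proof -
    have "2 * cmod (g x) = cmod (2 * g x)" by (simp add: norm_mult)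
    also have "\<dots> \<le> cmod (A x * exp (\<i> * k * x)) + cmod (B x * exp (\<i> * (- k) * x))"
      unfolding gAB by (rule norm_triangle_ineq4)
    finally have "2 * cmod (g x) * W x \<le> 2 * cmod k * u x"
      unfolding tri[symmetric] distrib_right[symmetric] by (intro mult_right_mono) (use W0[of x] in auto)
    then show ?thesis by simp
  qed
  have Ab: "A b = 2 * \<i> * k" "B b = 0"
    using ee[of b] by (simp_all add: A_def B_def fb algebra_simps)
  have cu: "continuous_on {0..b} u" unfolding u_def
    by (intro continuous_intros primitive_on_continuous[OF pA] primitive_on_continuous[OF pB]) (use k in auto)
  have qn: "(\<lambda>t. \<bar>q t\<bar>) absolutely_integrable_on {0..b}"
    by (rule absolutely_integrable_norm[OF q, unfolded o_def real_norm_def])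
  have iu: "(\<lambda>t. \<bar>q t\<bar> * u t) integrable_on {x..b}" if "x \<in> {0..b}" for x
    using absolutely_integrable_continuous_times(2)[OF cu qn] that
    by (auto simp: absolutely_integrable_on_def intro: integrable_subinterval_real)
  have step: "cmod (integral {x..b} (\<lambda>t. e t * (q t * f t))) * c \<le> integral {x..b} (\<lambda>t. \<bar>q t\<bar> * u t)"
    if x: "x \<in> {0..b}" and c: "0 \<le> c" and i: "(\<lambda>t. e t * (q t * f t)) integrable_on {x..b}"
      and le: "\<And>t. t \<in> {x..b} \<Longrightarrow> cmod (e t) * c \<le> W t" for x c and e :: "real \<Rightarrow> complex"
  proof -
    have "norm (integral {x..b} (\<lambda>t. e t * (q t * f t) * of_real c)) \<le> integral {x..b} (\<lambda>t. \<bar>q t\<bar> * u t)"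
    proof (rule Henstock_Kurzweil_Integration.integral_norm_bound_integral)
      show "(\<lambda>t. e t * (q t * f t) * of_real c) integrable_on {x..b}"
        by (intro integrable_on_mult_left i)
      fix t assume t: "t \<in> {x..b}"
      have "norm (e t * (q t * f t) * of_real c) = \<bar>q t\<bar> * (cmod (f t) * (cmod (e t) * c))"
        using c by (simp add: norm_mult)
      also have "\<dots> \<le> \<bar>q t\<bar> * (cmod (f t) * W t)" by (intro mult_left_mono le t) auto
      also have "\<dots> \<le> \<bar>q t\<bar> * u t" by (intro mult_left_mono fu) auto
      finally show "norm (e t * (q t * f t) * of_real c) \<le> \<bar>q t\<bar> * u t" .
    qed (rule iu[OF x])
    then show ?thesis using c by (simp add: norm_mult)
  qed
  have le: "u x \<le> 1 + integral {x..b} (\<lambda>t. \<bar>q t\<bar> / cmod k * u t)" if x: "x \<in> {0..b}" for x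
  proof -
    let ?I = "integral {x..b} (\<lambda>t. \<bar>q t\<bar> * u t)"
    have hA: "((\<lambda>t. exp (\<i> * (- k) * t) * (q t * f t)) has_integral (A b - A x)) {x..b}"
      using x by (intro primitive_onD[OF pA]) auto
    have hB: "((\<lambda>t. exp (\<i> * k * t) * (q t * f t)) has_integral (- (B b - B x))) {x..b}"
      using has_integral_neg[OF primitive_onD[OF pB, of x b]] x by auto
    have "cmod (A x) * exp (- 2 * \<kappa> * (b - x)) \<le>
        (2 * cmod k + cmod (A b - A x)) * exp (- 2 * \<kappa> * (b - x))"
      using norm_triangle_ineq4[of "A b" "A b - A x"] by (intro mult_right_mono) (auto simp: Ab norm_mult)
    also have "\<dots> \<le> 2 * cmod k + cmod (A b - A x) * exp (- 2 * \<kappa> * (b - x))"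
    proof -
      have "exp (- 2 * \<kappa> * (b - x)) \<le> 1" using \<kappa> x by (simp add: mult_nonneg_nonneg)
      then show ?thesis using kk by (simp add: distrib_right mult_left_le)
    qed
    also have "cmod (A b - A x) * exp (- 2 * \<kappa> * (b - x)) \<le> ?I"
      unfolding integral_unique[OF hA, symmetric]
    proof (rule step[OF x])
      fix t assume t: "t \<in> {x..b}"
      have "0 \<le> \<kappa> * (t - x)" using \<kappa> t by simp
      then show "cmod (exp (\<i> * (- k) * t)) * exp (- 2 * \<kappa> * (b - x)) \<le> W t"
        unfolding ne W_def exp_add[symmetric] exp_le_cancel_iff by (simp add: algebra_simps)
    qed (use hA in auto)
    finally have 1: "cmod (A x) * exp (- 2 * \<kappa> * (b - x)) \<le> 2 * cmod k + ?I" by simp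
    have "cmod (B x) * exp (2 * (\<eta> + \<kappa>) * x - 2 * \<kappa> * b) = 
       cmod (integral {x..b} (\<lambda>t. exp (\<i> * k * t) * (q t * f t))) * exp (2 * (\<eta> + \<kappa>) * x - 2 * \<kappa> * b)"
      unfolding integral_unique[OF hB] by (simp add: Ab)
    also have "\<dots> \<le> ?I"
    proof (rule step[OF x])
      fix t assume t: "t \<in> {x..b}"
      have "0 \<le> (\<eta> + \<kappa>) * (t - x)" using \<kappa> t by simp
      then show "cmod (exp (\<i> * k * t)) * exp (2 * (\<eta> + \<kappa>) * x - 2 * \<kappa> * b) \<le> W t"
        unfolding ne W_def exp_add[symmetric] exp_le_cancel_iff by (simp add: algebra_simps)
    qed (use hB in auto)
    finally have 2: "cmod (B x) * exp (2 * (\<eta> + \<kappa>) * x - 2 * \<kappa> * b) \<le> ?I" .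
    have "u x = (cmod (A x) * exp (- 2 * \<kappa> * (b - x)) + cmod (B x) * exp (2 * (\<eta> + \<kappa>) * x - 2 * \<kappa> * b)) / (2 * cmod k)"
      by (simp only: u_def)
    also have "\<dots> \<le> (2 * cmod k + ?I + ?I) / (2 * cmod k)"
    proof (rule divide_right_mono)
      show "cmod (A x) * exp (- 2 * \<kappa> * (b - x)) + cmod (B x) * exp (2 * (\<eta> + \<kappa>) * x - 2 * \<kappa> * b) \<le> 2 * cmod k + ?I + ?I"
        using 1 2 by linarith
    qed simp
    also have "\<dots> = 1 + ?I / cmod k" using kk by (simp add: field_simps)
    also have "?I / cmod k = integral {x..b} (\<lambda>t. \<bar>q t\<bar> / cmod k * u t)"
      by (subst Henstock_Kurzweil_Integration.integral_divide[symmetric]) simp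
    finally show ?thesis by simp
  qed
  have "u 0 \<le> 1 * exp (integral {0..b} (\<lambda>t. \<bar>q t\<bar> / cmod k))"
  proof (rule gronwall_integrable_kernel[OF _ _ cu le])
    show "(\<lambda>t. \<bar>q t\<bar> / cmod k) absolutely_integrable_on {0..b}"
      using absolutely_integrable_continuous_times(2)[of 0 b "\<lambda>_. 1 / cmod k", OF continuous_on_const qn] by simp
  qed (use b in auto)
  then have u0: "u 0 \<le> exp (integral {0..b} (\<lambda>t. \<bar>q t\<bar>) / cmod k)" by simp
  have E: "E = exp (integral {0..b} (\<lambda>t. \<bar>q t\<bar>) / cmod k) / W 0"
    unfolding E_def W_def exp_diff[symmetric] \<kappa>_def[symmetric] by (simp add: algebra_simps)
  have "cmod (f 0) * W 0 \<le> exp (integral {0..b} (\<lambda>t. \<bar>q t\<bar>) / cmod k)" using fu[of 0] u0 by linarith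
  then show "cmod (f 0) \<le> E" unfolding E using W0[of 0] by (simp add: field_simps)
  have "cmod k * u 0 \<le> cmod k * exp (integral {0..b} (\<lambda>t. \<bar>q t\<bar>) / cmod k)"
    by (intro mult_left_mono u0) simp
  then have "cmod (g 0) * W 0 \<le> cmod k * exp (integral {0..b} (\<lambda>t. \<bar>q t\<bar>) / cmod k)" using gu[of 0] by linarith
  then show "cmod (g 0) \<le> cmod k * E" unfolding E using W0[of 0] by (simp add: field_simps)
qed

text \<open>The derivative \<open>\<bar>g\<bar>\<^sup>2 + (q - \<kappa>\<^sup>2) \<bar>f\<bar>\<^sup>2\<close> of \<open>cnj f * g\<close> is real because \<open>q\<close> and \<open>\<kappa>\<close> are, so the
  imaginary part keeps its value at \<open>b\<close>.\<close>

lemma solves_on_flux: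
  fixes \<kappa> b :: real
  assumes s: "solves_on 0 b q (complex_of_real \<kappa>) f g" and b: "0 \<le> b"
    and fb: "f b = exp (\<i> * complex_of_real \<kappa> * b)" "g b = \<i> * complex_of_real \<kappa> * exp (\<i> * complex_of_real \<kappa> * b)"
  shows "Im (cnj (f 0) * g 0) = \<kappa>"
proof -
  have pf: "primitive_on 0 b g f" and pg: "primitive_on 0 b (\<lambda>t. (q t - (complex_of_real \<kappa>)\<^sup>2) * f t) g"
    using s by (auto simp: solves_on_def)
  have "((\<lambda>t. Im (cnj (g t) * g t + cnj (f t) * ((q t - (complex_of_real \<kappa>)\<^sup>2) * f t))) has_integral
      Im (cnj (f b) * g b - cnj (f 0) * g 0)) {0..b}"
    by (rule has_integral_Im[OF primitive_onD[OF primitive_on_mult[OF primitive_on_cnj[OF pf] pg]]])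
       (use b in auto)
  moreover have "Im (cnj (g t) * g t + cnj (f t) * ((q t - (complex_of_real \<kappa>)\<^sup>2) * f t)) = 0" for t
    by (simp add: power2_eq_square algebra_simps)
  ultimately have "Im (cnj (f b) * g b - cnj (f 0) * g 0) = 0"
    using has_integral_unique has_integral_0 by fastforce
  moreover have "cnj (f b) * g b = \<i> * \<kappa>"
  proof -
    have "cnj (exp (\<i> * complex_of_real \<kappa> * b)) * exp (\<i> * complex_of_real \<kappa> * b) = 1"
      by (simp add: exp_cnj flip: exp_add)
    then show ?thesis by (simp add: fb)
  qed
  ultimately show ?thesis by simp
qed

text \<open>The second bound rests on \<open>\<bar>v + i\<kappa>u\<bar>\<^sup>2 - \<bar>v - i\<kappa>u\<bar>\<^sup>2 = 4\<kappa> Im (cnj u * v)\<close>; for the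
  Wronskian \<open>2i\<kappa> / T\<close> it says that the transmission coefficient \<open>T\<close> has modulus at most \<open>1\<close>.\<close>

lemma flux_lower_bounds:
  fixes \<kappa> :: real
  assumes "Im (cnj u * v) = \<kappa>" "0 < \<kappa>"
  shows "\<kappa> \<le> cmod u * cmod v" and "2 * \<kappa> \<le> cmod (v + \<i> * \<kappa> * u)"
proof -
  have "\<kappa> \<le> cmod (cnj u * v)" using assms(1) abs_Im_le_cmod[of "cnj u * v"] by linarith
  then show "\<kappa> \<le> cmod u * cmod v" by (simp add: norm_mult)
  have "(cmod (v + \<i> * \<kappa> * u))\<^sup>2 = (cmod (v - \<i> * \<kappa> * u))\<^sup>2 + 4 * \<kappa> * Im (cnj u * v)"
    unfolding cmod_power2 by (simp add: power2_eq_square algebra_simps)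
  then have "(cmod (v + \<i> * \<kappa> * u))\<^sup>2 = (cmod (v - \<i> * \<kappa> * u))\<^sup>2 + (2 * \<kappa>)\<^sup>2"
    unfolding assms(1) by (simp add: power2_eq_square)
  then have "(2 * \<kappa>)\<^sup>2 \<le> (cmod (v + \<i> * \<kappa> * u))\<^sup>2" by simp
  then show "2 * \<kappa> \<le> cmod (v + \<i> * \<kappa> * u)" by (rule power2_le_imp_le) simp
qed

section \<open>Jensen's formula\<close>

text \<open>A zero-free function on a disc is \<open>exp H\<close>, and \<open>ln \<bar>\<phi>\<bar> = Re H\<close> has the mean value property by
  Cauchy's formula at the centre.\<close>

lemma ln_norm_mean_zero_free:
  fixes s R' :: real
  assumes hol: "\<phi> holomorphic_on ball c R'" and nz: "\<And>z. z \<in> ball c R' \<Longrightarrow> \<phi> z \<noteq> 0"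
    and s: "0 < s" "s < R'"
  shows "((\<lambda>t. ln (cmod (\<phi> (c + s * exp (2 * of_real pi * \<i> * of_real t))))) has_integral ln (cmod (\<phi> c))) {0..1}"
proof -
  obtain H where H: "H holomorphic_on ball c R'" "\<And>z. z \<in> ball c R' \<Longrightarrow> \<phi> z = exp (H z)"
    by (rule contractible_imp_holomorphic_log[OF hol convex_imp_contractible nz]) auto
  have "((\<lambda>w. H w / (w - c)) has_contour_integral (2 * of_real pi * \<i> * H c)) (circlepath c s)"
  proof (rule Cauchy_integral_circlepath)
    show "continuous_on (cball c s) H"
      using s by (intro holomorphic_on_imp_continuous_on holomorphic_on_subset[OF H(1)]) auto
    show "H holomorphic_on ball c s"
      using s by (intro holomorphic_on_subset[OF H(1)]) auto
  qed (use s in auto)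
  then have "((\<lambda>t. 2 * of_real pi * \<i> * H (c + s * exp (2 * of_real pi * \<i> * of_real t))) has_integral (2 * of_real pi * \<i> * H c)) {0..1}"
    unfolding has_contour_integral vector_derivative_circlepath unfolding circlepath
    by (rule has_integral_eq[rotated]) (use s in \<open>auto simp: field_simps\<close>)
  from has_integral_mult_right[OF this, of "inverse (2 * of_real pi * \<i>)"]
  have "((\<lambda>t. H (c + s * exp (2 * of_real pi * \<i> * of_real t))) has_integral H c) {0..1}"
    by (simp add: field_simps)
  from has_integral_Re[OF this]
  have "((\<lambda>t. Re (H (c + s * exp (2 * of_real pi * \<i> * of_real t)))) has_integral Re (H c)) {0..1}" .
  moreover have "Re (H z) = ln (cmod (\<phi> z))" if "z \<in> ball c R'" for z using H(2)[OF that] by simp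
  from this[of c] this[of "c + s * exp (2 * of_real pi * \<i> * of_real t)" for t]
  have "Re (H c) = ln (cmod (\<phi> c))"
    "Re (H (c + s * exp (2 * of_real pi * \<i> * of_real t))) = ln (cmod (\<phi> (c + s * exp (2 * of_real pi * \<i> * of_real t))))" for t
    using s by (simp_all add: dist_norm norm_mult)
  ultimately show ?thesis by (simp only:)
qed

text \<open>If \<open>a\<close> lies inside the circle, then on the circle \<open>\<bar>z - a\<bar>\<close> agrees with the modulus of the reflected
  factor \<open>s - cnj (a - c) e\<close>, where \<open>z = c + s e\<close>, which has no zero in the closed unit disc of \<open>e\<close>.\<close>

lemma ln_norm_mean_linear:
  fixes s :: real
  assumes s: "0 < s" and a: "cmod (a - c) \<noteq> s"
  shows "((\<lambda>t. ln (cmod (c + s * exp (2 * of_real pi * \<i> * of_real t) - a))) has_integral ln (max s (cmod (a - c)))) {0..1}"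
proof (cases "s < cmod (a - c)")
  case True
  have "((\<lambda>t. ln (cmod (c + s * exp (2 * of_real pi * \<i> * of_real t) - a))) has_integral ln (cmod (c - a))) {0..1}"
    by (rule ln_norm_mean_zero_free[of "\<lambda>z. z - a" c "cmod (a - c)"])
       (use s True in \<open>auto simp: dist_norm norm_minus_commute intro!: holomorphic_intros\<close>)
  then show ?thesis using True by (simp add: norm_minus_commute max_def)
next
  case False
  then have lt: "cmod (a - c) < s" using a by auto
  define \<beta> where "\<beta> = cnj (a - c)"
  have \<beta>: "cmod \<beta> < s" using lt by (simp add: \<beta>_def del: complex_cnj_diff)
  \<comment> \<open>Any radius between \<open>1\<close> and \<open>s / \<bar>\<beta>\<bar>\<close> would do; this one also makes sense for \<open>\<beta> = 0\<close>.\<close>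
  define R' where "R' = 2 * s / (s + cmod \<beta>)"
  have den: "0 < s + cmod \<beta>" using s by (intro add_pos_nonneg) auto
  have R': "1 < R'" using \<beta> den by (simp add: R'_def)
  have "((\<lambda>t. ln (cmod (s - \<beta> * (0 + (1::real) * exp (2 * of_real pi * \<i> * of_real t))))) has_integral ln (cmod (s - \<beta> * 0))) {0..1}"
  proof (rule ln_norm_mean_zero_free[of "\<lambda>z. s - \<beta> * z" 0 R'])
    fix z :: complex assume "z \<in> ball 0 R'"
    then have "cmod z \<le> R'" by simp
    then have "cmod \<beta> * cmod z \<le> cmod \<beta> * R'" by (rule mult_left_mono) simp
    also have "\<dots> < s"
    proof -
      have "2 * cmod \<beta> < s + cmod \<beta>" using \<beta> by simp
      then have "s * (2 * cmod \<beta>) < s * (s + cmod \<beta>)" using s by (rule mult_strict_left_mono)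
      then show ?thesis unfolding R'_def using den by (simp add: field_simps)
    qed
    finally have "cmod (\<beta> * z) < cmod (complex_of_real s)" using s by (simp add: norm_mult)
    then show "s - \<beta> * z \<noteq> 0" by (metis eq_iff_diff_eq_0 less_irrefl)
  qed (use R' in \<open>auto intro!: holomorphic_intros\<close>)
  moreover have "cmod (s - \<beta> * (0 + (1::real) * exp (2 * of_real pi * \<i> * of_real t))) = cmod (c + s * exp (2 * of_real pi * \<i> * of_real t) - a)"
    for t :: real
  proof -
    let ?e = "exp (2 * of_real pi * \<i> * of_real t)"
    have e: "cnj ?e * ?e = 1" by (simp add: exp_cnj flip: exp_add)
    have n: "cmod ?e = 1" by simp
    have "cmod (s - \<beta> * ?e) = cmod (cnj (s - \<beta> * ?e)) * cmod ?e" by (simp only: complex_mod_cnj n)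
    also have "\<dots> = cmod ((s - (a - c) * cnj ?e) * ?e)" unfolding norm_mult by (simp add: \<beta>_def)
    also have "(s - (a - c) * cnj ?e) * ?e = c + s * ?e - a"
      using e by (simp add: algebra_simps)
    finally show ?thesis by simp
  qed
  ultimately show ?thesis using s lt by (simp add: max_def)
qed

lemma zorder_prod_linear_powers:
  fixes m :: "complex \<Rightarrow> nat"
  assumes "finite Z" "a \<in> Z"
  shows "zorder (\<lambda>z. \<Prod>b\<in>Z. (z - b) ^ m b) a = int (m a)"
proof (rule zorder_eqI[where S = UNIV and g = "\<lambda>z. \<Prod>b\<in>Z - {a}. (z - b) ^ m b"])
  show "(\<Prod>b\<in>Z. (w - b) ^ m b) = (\<Prod>b\<in>Z - {a}. (w - b) ^ m b) * (w - a) powi int (m a)" for w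
    using assms by (simp add: prod.remove mult.commute)
qed (use assms in \<open>auto intro!: holomorphic_intros\<close>)

lemma entire_zorder_nonneg:
  assumes hol: "f holomorphic_on UNIV" and c: "f c \<noteq> 0"
  shows "0 \<le> zorder f z"
proof (rule zorder_ge_0)
  show "f analytic_on {z}" using hol by (meson UNIV_I analytic_at open_UNIV)
  have "eventually (\<lambda>w. f w \<noteq> 0 \<and> w \<in> UNIV) (at z)"
    by (rule non_zero_neighbour_alt[OF hol _ _ _ _ c]) auto
  then show "\<exists>\<^sub>F w in at z. f w \<noteq> 0"
    by (intro eventually_frequently) (auto elim: eventually_mono)
qed

lemma entire_finite_zeros:
  assumes hol: "f holomorphic_on UNIV" and c: "f c \<noteq> 0" and K: "compact K"
  shows "finite {z \<in> K. f z = 0}"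
proof (cases "\<exists>d. \<forall>z. f z = d")
  case True
  then show ?thesis using c by auto
next
  case False
  then have "\<not> f constant_on UNIV" by (auto simp: constant_on_def)
  then show ?thesis by (intro holomorphic_compact_finite_zeros[OF hol _ _ K]) auto
qed

text \<open>Dividing out the finitely many zeros leaves a zero-free factor; the mean of \<open>ln \<bar>f\<bar>\<close> is the sum of
  the means for the factors. Radii passing through a zero are excluded, which avoids logarithmic
  singularities in the integrand.\<close>

lemma jensen_formula:
  assumes hol: "f holomorphic_on UNIV" and c: "f c \<noteq> 0" and s: "0 < s" "s < R"
    and Z: "Z = {z \<in> cball c R. f z = 0}" and ns: "\<And>z. z \<in> Z \<Longrightarrow> cmod (z - c) \<noteq> s"
  shows "((\<lambda>t. ln (cmod (f (c + s * exp (2 * of_real pi * \<i> * of_real t))))) has_integral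
     ln (cmod (f c)) + (\<Sum>a\<in>Z. real_of_int (zorder f a) * (ln (max s (cmod (a - c))) - ln (cmod (a - c))))) {0..1}"
proof -
  define m where "m a = nat (zorder f a)" for a
  define P where "P z = (\<Prod>b\<in>Z. (z - b) ^ m b)" for z
  have fin: "finite Z" unfolding Z by (intro entire_finite_zeros[OF hol c]) auto
  have z0: "zorder f a \<ge> 0" for a by (rule entire_zorder_nonneg[OF hol c])
  have mpos: "m a > 0" if "a \<in> Z" for a
  proof -
    have "frequently (\<lambda>z. f z \<noteq> 0) (at a)"
    proof (rule eventually_frequently)
      have "eventually (\<lambda>w. f w \<noteq> 0 \<and> w \<in> UNIV) (at a)"
        by (rule non_zero_neighbour_alt[OF hol _ _ _ _ c]) auto
      then show "eventually (\<lambda>w. f w \<noteq> 0) (at a)" by (auto elim: eventually_mono)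
    qed simp
    then have "zorder f a > 0" using zorder_pos_iff[OF hol _ _ _, of a] that by (auto simp: Z)
    then show ?thesis by (simp add: m_def)
  qed
  have P0: "P z = 0 \<longleftrightarrow> z \<in> Z" for z
    using fin mpos by (auto simp: P_def)
  have holP: "P holomorphic_on A" for A unfolding P_def by (intro holomorphic_intros)
  obtain h where h: "h holomorphic_on ball c R" "\<And>z. z \<in> ball c R \<Longrightarrow> h z \<noteq> 0"
    "\<And>z. z \<in> ball c R \<Longrightarrow> f z = h z * P z"
  proof (rule holomorphic_zorder_factorization[of f "ball c R" P])
    show "f holomorphic_on ball c R" by (rule holomorphic_on_subset[OF hol]) auto
    show "P holomorphic_on ball c R" by (rule holP)
    fix z assume z: "z \<in> ball c R"
    show *: "P z = 0 \<longleftrightarrow> f z = 0" using z by (auto simp: P0 Z)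
    show "zorder P z = zorder f z"
    proof (cases "z \<in> Z")
      case True
      then show ?thesis using zorder_prod_linear_powers[OF fin True, of m] z0[of z]
        unfolding P_def m_def by simp
    next
      case False
      have "zorder P z = 0"
        by (rule zorder_eq_0I) (use holP[of UNIV] False P0 in \<open>auto simp: analytic_at intro!: exI[of _ UNIV]\<close>)
      moreover have "zorder f z = 0"
        by (rule zorder_eq_0I) (use hol False P0 * in \<open>auto simp: analytic_at intro!: exI[of _ UNIV]\<close>)
      ultimately show ?thesis by simp
    qed
  qed auto
  let ?e = "\<lambda>t. c + s * exp (2 * of_real pi * \<i> * of_real t)"
  have lnf: "ln (cmod (f z)) = ln (cmod (h z)) + (\<Sum>a\<in>Z. real (m a) * ln (cmod (z - a)))"
    if "z \<in> ball c R" "z \<notin> Z" for z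
  proof -
    have "ln (cmod (P z)) = (\<Sum>a\<in>Z. ln (cmod (z - a) ^ m a))"
      unfolding P_def prod_norm[symmetric] norm_power
      by (rule ln_prod) (use fin that in auto)
    also have "\<dots> = (\<Sum>a\<in>Z. real (m a) * ln (cmod (z - a)))"
      by (intro sum.cong refl ln_realpow)
    finally show ?thesis using that h(2)[OF that(1)] P0[of z]
      by (simp add: h(3) norm_mult ln_mult)
  qed
  have "((\<lambda>t. ln (cmod (h (?e t))) + (\<Sum>a\<in>Z. real (m a) * ln (cmod (?e t - a)))) has_integral
     ln (cmod (h c)) + (\<Sum>a\<in>Z. real (m a) * ln (max s (cmod (a - c))))) {0..1}"
    by (intro has_integral_add has_integral_sum has_integral_mult_right fin
        ln_norm_mean_zero_free[OF h(1,2) s] ln_norm_mean_linear s ns)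
  then have "((\<lambda>t. ln (cmod (f (?e t)))) has_integral
     ln (cmod (h c)) + (\<Sum>a\<in>Z. real (m a) * ln (max s (cmod (a - c))))) {0..1}"
  proof (rule has_integral_eq[rotated])
    fix t :: real
    have d: "dist c (?e t) = s" "cmod (?e t - c) = s" using s by (simp_all add: dist_norm norm_mult)
    then have e: "?e t \<in> ball c R" "?e t \<notin> Z" using s ns[of "?e t"] by auto
    show "ln (cmod (h (?e t))) + (\<Sum>a\<in>Z. real (m a) * ln (cmod (?e t - a))) = ln (cmod (f (?e t)))"
      by (rule lnf[OF e, symmetric])
  qed
  moreover have "ln (cmod (f c)) = ln (cmod (h c)) + (\<Sum>a\<in>Z. real (m a) * ln (cmod (a - c)))"
  proof -
    have "c \<in> ball c R" "c \<notin> Z" using s c by (auto simp: Z)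
    from lnf[OF this] show ?thesis by (simp only: norm_minus_commute)
  qed
  moreover have "real (m a) = real_of_int (zorder f a)" for a using z0[of a] by (simp add: m_def)
  ultimately show ?thesis
    by (simp add: right_diff_distrib sum_subtractf)
qed

lemma lower_half_sine_mean:
  fixes s :: real
  assumes "0 \<le> s"
  shows "((\<lambda>t. max 0 (- (s * sin (2 * pi * t)))) has_integral s / pi) {0..1}"
proof -
  have 1: "((\<lambda>t. max 0 (- (s * sin (2 * pi * t)))) has_integral 0) {0..1/2}"
  proof (rule has_integral_eq[OF _ has_integral_0])
    fix t :: real assume t: "t \<in> {0..1/2}"
    have "2 * pi * t \<le> 2 * pi * (1/2)" by (rule mult_left_mono) (use t in auto)
    then have "0 \<le> sin (2 * pi * t)" using t by (intro sin_ge_zero) auto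
    then show "0 = max 0 (- (s * sin (2 * pi * t)))" using assms by simp
  qed
  have "((\<lambda>t. - (s * sin (2 * pi * t))) has_integral
      s * cos (2 * pi * 1) / (2 * pi) - s * cos (2 * pi * (1/2)) / (2 * pi)) {1/2..1}"
    by (rule fundamental_theorem_of_calculus)
       (auto intro!: derivative_eq_intros simp: has_real_derivative_iff_has_vector_derivative[symmetric])
  then have "((\<lambda>t. - (s * sin (2 * pi * t))) has_integral s / pi) {1/2..1}"
    by (simp add: field_simps)
  then have 2: "((\<lambda>t. max 0 (- (s * sin (2 * pi * t)))) has_integral s / pi) {1/2..1}"
  proof (rule has_integral_eq[rotated])
    fix t :: real assume t: "t \<in> {1/2..1}"
    have "sin (2 * pi * (t - 1/2)) \<ge> 0"
    proof (rule sin_ge_zero)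
      have "2 * pi * (t - 1/2) \<le> 2 * pi * (1/2)" by (rule mult_left_mono) (use t in auto)
      then show "2 * pi * (t - 1/2) \<le> pi" by simp
    qed (use t in auto)
    moreover have "sin (2 * pi * (t - 1/2)) = - sin (2 * pi * t)"
      by (simp add: algebra_simps sin_diff)
    ultimately have "s * sin (2 * pi * t) \<le> 0" using assms by (simp add: mult_le_0_iff)
    then show "- (s * sin (2 * pi * t)) = max 0 (- (s * sin (2 * pi * t)))" by simp
  qed
  show ?thesis using has_integral_combine[OF _ _ 1 2] by simp
qed

text \<open>Jensen's inequality for a majorant that grows exponentially in the lower half-plane only. In Jensen's
  formula each zero in the smaller disc contributes at least \<open>ln (s / \<rho>)\<close> and every other zero a
  nonnegative amount. The majorant is assumed on an annulus below \<open>R\<close>, because circles through zeros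
  have to be avoided and radius \<open>R\<close> itself is reached as a limit.\<close>

lemma jensen_zero_count:
  fixes D \<beta> \<rho> R R0 r :: real
  assumes hol: "f holomorphic_on UNIV" and c: "f c \<noteq> 0"
    and \<rho>: "0 < \<rho>" "\<rho> < R" "0 \<le> R0" "R0 < R" and sub: "\<And>z. cmod z \<le> r \<Longrightarrow> cmod (z - c) \<le> \<rho>"
    and D: "0 < D" and bound: "\<And>z. R0 \<le> cmod (z - c) \<Longrightarrow> cmod (z - c) \<le> R \<Longrightarrow>
      cmod (f z) \<le> D * exp (\<beta> * max 0 (- Im (z - c)))"
  obtains n :: real where "zero_count r f = ereal n"
    "n * ln (R / \<rho>) \<le> ln D + \<beta> * R / pi - ln (cmod (f c))"
proof -
  define Zr where "Zr = {z. cmod z \<le> r \<and> f z = 0}"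
  define Z where "Z = {z \<in> cball c R. f z = 0}"
  have fin: "finite Z" unfolding Z_def by (intro entire_finite_zeros[OF hol c]) auto
  have ZrZ: "Zr \<subseteq> Z" using sub \<rho> by (fastforce simp: Zr_def Z_def dist_norm norm_minus_commute)
  have finr: "finite Zr" using finite_subset[OF ZrZ fin] .
  define n where "n = (\<Sum>z\<in>Zr. real_of_int (zorder f z))"
  have zc: "zero_count r f = ereal n"
    using finr unfolding zero_count_def Zr_def n_def Let_def by simp
  have z0: "zorder f a \<ge> 0" for a by (rule entire_zorder_nonneg[OF hol c])
  have *: "n * ln (s / \<rho>) \<le> ln D + \<beta> * s / pi - ln (cmod (f c))"
    if s: "max \<rho> R0 < s" "s < R" and ns: "\<And>z. z \<in> Z \<Longrightarrow> cmod (z - c) \<noteq> s" for s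
  proof -
    have s0: "0 < s" using s \<rho> by auto
    let ?T = "\<lambda>a. real_of_int (zorder f a) * (ln (max s (cmod (a - c))) - ln (cmod (a - c)))"
    have ac: "0 < cmod (a - c)" if "a \<in> Z" for a using that c by (auto simp: Z_def)
    have "n * ln (s / \<rho>) = (\<Sum>a\<in>Zr. real_of_int (zorder f a) * ln (s / \<rho>))"
      by (simp add: n_def sum_distrib_right)
    also have "\<dots> \<le> (\<Sum>a\<in>Zr. ?T a)"
    proof (intro sum_mono mult_left_mono)
      fix a assume a: "a \<in> Zr"
      have le: "cmod (a - c) \<le> \<rho>" using a sub by (auto simp: Zr_def)
      have pos: "0 < cmod (a - c)" using ac a ZrZ by auto
      have "ln (s / \<rho>) = ln s - ln \<rho>" using s0 \<rho> by (simp add: ln_div)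
      also have "\<dots> \<le> ln (max s (cmod (a - c))) - ln (cmod (a - c))"
        using le pos s0 \<rho> by (intro diff_mono) auto
      finally show "ln (s / \<rho>) \<le> ln (max s (cmod (a - c))) - ln (cmod (a - c))" .
    qed (use z0 in auto)
    also have "\<dots> \<le> (\<Sum>a\<in>Z. ?T a)"
    proof (rule sum_mono2[OF fin ZrZ])
      fix a assume a: "a \<in> Z - Zr"
      then have "ln (cmod (a - c)) \<le> ln (max s (cmod (a - c)))" using ac[of a] s0 by auto
      then show "0 \<le> ?T a" using z0[of a] by simp
    qed
    also have "\<dots> \<le> ln D + \<beta> * (s / pi) - ln (cmod (f c))"
    proof -
      have "ln (cmod (f c)) + (\<Sum>a\<in>Z. ?T a) \<le> ln D + \<beta> * (s / pi)"
      proof (rule has_integral_le[OF jensen_formula[OF hol c s0 s(2) Z_def ns]])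
        show "((\<lambda>t. ln D + \<beta> * max 0 (- (s * sin (2 * pi * t)))) has_integral ln D + \<beta> * (s / pi)) {0..1}"
          using has_integral_add[OF has_integral_const_real[of "ln D" 0 1]
             has_integral_mult_right[OF lower_half_sine_mean[of s], of \<beta>]] s0 by simp
        fix t :: real
        define z where "z = c + s * exp (2 * of_real pi * \<i> * of_real t)"
        have zs: "cmod (z - c) = s" "Im (z - c) = s * sin (2 * pi * t)"
          using s0 by (simp_all add: z_def norm_mult Im_exp)
        have "z \<notin> Z" using ns zs by auto
        then have "f z \<noteq> 0" using zs s by (auto simp: Z_def dist_norm norm_minus_commute)
        moreover have "cmod (f z) \<le> D * exp (\<beta> * max 0 (- Im (z - c)))"
          using s zs by (intro bound) auto
        ultimately have "ln (cmod (f z)) \<le> ln (D * exp (\<beta> * max 0 (- Im (z - c))))"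
          by (subst ln_le_cancel_iff) (use D in auto)
        also have "\<dots> = ln D + \<beta> * max 0 (- (s * sin (2 * pi * t)))" unfolding zs(2) using D by (simp add: ln_mult)
        finally show "ln (cmod (f z)) \<le> ln D + \<beta> * max 0 (- (s * sin (2 * pi * t)))" .
      qed
      then show ?thesis by simp
    qed
    finally show ?thesis by simp
  qed
  \<comment> \<open>Only finitely many radii pass through zeros, so the estimate holds for all \<open>s < R\<close> close enough to \<open>R\<close>.\<close>
  have ev: "eventually (\<lambda>s. n * ln (s / \<rho>) \<le> ln D + \<beta> * s / pi - ln (cmod (f c))) (at_left R)"
  proof -
    have "eventually (\<lambda>s. s \<in> {max \<rho> R0<..<R}) (at_left R)"
      using \<rho> by (intro eventually_at_leftI[of "max \<rho> R0"]) auto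
    moreover have "eventually (\<lambda>s. s \<in> - ((\<lambda>z. cmod (z - c)) ` Z - {R})) (at_left R)"
    proof -
      have "open (- ((\<lambda>z. cmod (z - c)) ` Z - {R}))" using fin by (intro open_Compl finite_imp_closed) auto
      then have "eventually (\<lambda>s. s \<in> - ((\<lambda>z. cmod (z - c)) ` Z - {R})) (nhds R)"
        by (rule eventually_nhds_in_open) auto
      then show ?thesis unfolding eventually_at_filter by (rule eventually_mono) auto
    qed
    ultimately show ?thesis
      by eventually_elim (rule *, auto)
  qed
  have "n * ln (R / \<rho>) \<le> ln D + \<beta> * R / pi - ln (cmod (f c))"
  proof (rule tendsto_le[OF _ _ _ ev])
    show "((\<lambda>s. n * ln (s / \<rho>)) \<longlongrightarrow> n * ln (R / \<rho>)) (at_left R)"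
      using \<rho> by (intro tendsto_intros) auto
    show "((\<lambda>s. ln D + \<beta> * s / pi - ln (cmod (f c))) \<longlongrightarrow> ln D + \<beta> * R / pi - ln (cmod (f c))) (at_left R)"
      by (intro tendsto_intros) auto
  qed simp
  then show ?thesis using that zc by blast
qed

section \<open>Counting the zeros\<close>

text \<open>Around each point off the essential support \<open>q\<close> vanishes almost everywhere, and negligibility is a
  local property.\<close>

lemma negligible_off_ess_support:
  "negligible {t \<in> I. t \<notin> ess_support I q \<and> q t \<noteq> 0}" (is "negligible ?S")
  unfolding locally_negligible_alt[of ?S]
proof
  fix x assume x: "x \<in> ?S"
  then obtain e where e: "e > 0" "negligible {t \<in> I \<inter> ball x e. q t \<noteq> 0}"
    by (auto simp: ess_support_def)
  show "\<exists>U. openin (top_of_set ?S) U \<and> x \<in> U \<and> negligible U"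
  proof (intro exI conjI)
    show "openin (top_of_set ?S) (?S \<inter> ball x e)" by (intro openin_open_Int) auto
    show "x \<in> ?S \<inter> ball x e" using x e by auto
    show "negligible (?S \<inter> ball x e)" by (rule negligible_subset[OF e(2)]) auto
  qed
qed

text \<open>The inner radius of the annulus about \<open>1/2\<close> is chosen so that \<open>\<bar>z\<bar> \<ge> (1 + 4 r1) / 9\<close> on it, which is
  where the constant \<open>9\<close> enters; on its outer edge \<open>\<bar>z\<bar> \<le> 2 r1 + 1/2\<close>.\<close>

lemma jost_annulus_bounds:
  fixes r1 \<gamma> M :: real and z :: complex
  assumes s: "solves_on 0 \<gamma> q z f g" and q: "q absolutely_integrable_on {0..\<gamma>}" and \<gamma>: "0 \<le> \<gamma>"
    and b: "f \<gamma> = exp (\<i> * z * \<gamma>)" "g \<gamma> = \<i> * z * exp (\<i> * z * \<gamma>)"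
    and M: "integral {0..\<gamma>} (\<lambda>t. \<bar>q t\<bar>) \<le> M" and r1: "0 < r1"
    and z: "(1 + 4 * r1) / 9 + 1/2 \<le> cmod (z - 1/2)" "cmod (z - 1/2) \<le> 2 * r1"
  defines "B \<equiv> exp (9 * M / (1 + 4 * r1)) * exp (2 * \<gamma> * max 0 (- Im (z - 1/2)))"
  shows "cmod (f 0) \<le> B" "cmod (g 0) \<le> (2 * r1 + 1/2) * B"
    "cmod (g 0 + \<i> * z * f 0) \<le> (1 + 4 * r1) * B"
proof -
  have zl: "(1 + 4 * r1) / 9 \<le> cmod z"
  proof -
    have "cmod (z - 1/2) \<le> cmod z + 1/2" using norm_triangle_ineq4[of z "1/2"] by (simp add: norm_divide)
    then show ?thesis using z(1) by linarith
  qed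
  have zu: "cmod z \<le> 2 * r1 + 1/2"
  proof -
    have "cmod z \<le> cmod (z - 1/2) + 1/2" using norm_triangle_ineq[of "z - 1/2" "1/2"] by (simp add: norm_divide)
    then show ?thesis using z(2) by linarith
  qed
  have z0: "0 < cmod z" using zl r1 by (auto intro: less_le_trans[rotated])
  let ?I = "integral {0..\<gamma>} (\<lambda>t. \<bar>q t\<bar>)"
  have "0 \<le> ?I" by (intro integral_nonneg) (use q in \<open>auto simp: absolutely_integrable_on_def\<close>)
  then have "?I / cmod z \<le> M / ((1 + 4 * r1) / 9)"
    using zl r1 M by (intro frac_le) auto
  then have E: "exp (2 * \<gamma> * max 0 (- Im z) + ?I / cmod z) \<le> B"
    unfolding B_def exp_add[symmetric] by (simp add: algebra_simps)
  have B: "0 \<le> B" by (simp add: B_def)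
  have z': "z \<noteq> 0" using z0 by auto
  note bd = solves_on_modulus_bound[OF s q \<gamma> z' b]
  show f: "cmod (f 0) \<le> B" using bd(1) E by linarith
  have "cmod z * exp (2 * \<gamma> * max 0 (- Im z) + ?I / cmod z) \<le> (2 * r1 + 1/2) * B"
    using zu E r1 by (intro mult_mono) auto
  then show g: "cmod (g 0) \<le> (2 * r1 + 1/2) * B" using bd(2) by linarith
  have "cmod (\<i> * z * f 0) \<le> (2 * r1 + 1/2) * B"
    unfolding norm_mult using zu f r1 by (auto intro!: mult_mono)
  with g norm_triangle_ineq[of "g 0" "\<i> * z * f 0"]
  show "cmod (g 0 + \<i> * z * f 0) \<le> (1 + 4 * r1) * B" by (simp add: algebra_simps)
qed

text \<open>The case of centre \<open>1/2\<close> and radii \<open>r1\<close> and \<open>2 r1\<close>. The annulus is nonempty because \<open>r1 > 1/2\<close>.\<close>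

lemma zero_count_le_two_discs_at_half:
  fixes r r1 \<gamma> D :: real
  assumes r: "0 < r" "r1 = r + 1/2" and hol: "f holomorphic_on UNIV" and c: "f (1/2) \<noteq> 0" and D: "0 < D"
    and bound: "\<And>z. (1 + 4 * r1) / 9 + 1/2 \<le> cmod (z - 1/2) \<Longrightarrow> cmod (z - 1/2) \<le> 2 * r1 \<Longrightarrow>
      cmod (f z) \<le> D * exp (2 * \<gamma> * max 0 (- Im (z - 1/2)))"
  obtains n :: real where "zero_count r f = ereal n"
    "n * ln 2 \<le> ln D + 4 * r1 * \<gamma> / pi - ln (cmod (f (1/2)))"
proof -
  have sub: "cmod (z - 1/2) \<le> r1" if "cmod z \<le> r" for z
  proof -
    have "cmod (z - 1/2) \<le> cmod z + 1/2" using norm_triangle_ineq4[of z "1/2"] by (simp add: norm_divide)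
    then show ?thesis using that r by linarith
  qed
  have R0: "0 < r1" "r1 < 2 * r1" "0 \<le> (1 + 4 * r1) / 9 + 1/2" "(1 + 4 * r1) / 9 + 1/2 < 2 * r1"
    using r by (simp_all add: field_simps)
  obtain n where n: "zero_count r f = ereal n"
    "n * ln (2 * r1 / r1) \<le> ln D + 2 * \<gamma> * (2 * r1) / pi - ln (cmod (f (1/2)))"
    by (rule jensen_zero_count[OF hol c R0 sub D bound])
  have "ln (2 * r1 / r1) = ln 2" using R0(1) by simp
  moreover have "2 * \<gamma> * (2 * r1) = 4 * r1 * \<gamma>" by simp
  ultimately show ?thesis using n by (intro that[of n]) (simp_all only:)
qed

lemma wronskian_zero_count_bound:
  fixes r r1 \<gamma> Q :: real and q :: "real \<Rightarrow> real"
  assumes r: "0 < r" "r1 = r + 1/2" and q: "q absolutely_integrable_on UNIV" and \<gamma>: "0 \<le> \<gamma>"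
    and supp: "ess_support UNIV q \<subseteq> {0..\<gamma>}" and Q: "integral UNIV (\<lambda>t. \<bar>q t\<bar>) \<le> Q"
  shows "zero_count r (jost_wronskian q x)
     \<le> ereal (1 / ln 2 * (4 * r1 * \<gamma> / pi + ln (1 + 4 * r1) + 9 * Q / (1 + 4 * r1)))"
proof -
  have qa: "q absolutely_integrable_on {a..c}" for a c
    using q by (rule absolutely_integrable_on_subinterval) auto
  have N: "negligible {t. \<gamma> < t \<and> q t \<noteq> 0}" "negligible {t. t < 0 \<and> q t \<noteq> 0}"
    by (rule negligible_subset[OF negligible_off_ess_support[of UNIV q]], use supp in force)+
  obtain F G :: "complex \<Rightarrow> real \<Rightarrow> complex" where FG:
    "\<And>x. (\<lambda>k. F k x) holomorphic_on UNIV" "\<And>x. (\<lambda>k. G k x) holomorphic_on UNIV"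
    "\<And>k x. \<gamma> \<le> x \<Longrightarrow> F k x = exp (\<i> * k * x)" "\<And>k x. \<gamma> \<le> x \<Longrightarrow> G k x = \<i> * k * exp (\<i> * k * x)"
    "\<And>a c k. solves_on a c q k (F k) (G k)"
    by (rule jost_family_exists[OF qa N(1)]) blast
  define w where "w k = G k 0 + \<i> * k * F k 0" for k
  have W: "jost_wronskian q x = w"
    unfolding w_def by (rule ext) (rule jost_wronskian_eq[OF qa N(2) FG(1,3,5)])
  have hol: "w holomorphic_on UNIV" unfolding w_def by (intro holomorphic_intros FG)
  have "Im (cnj (F (1/2) 0) * G (1/2) 0) = 1/2"
    using solves_on_flux[of \<gamma> q "1/2" "F (1/2)" "G (1/2)"] FG(3)[of \<gamma> "1/2"] FG(4)[of \<gamma> "1/2"] FG(5) \<gamma> by simp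
  from flux_lower_bounds(2)[OF this] have w1: "1 \<le> cmod (w (1/2))" by (simp add: w_def)
  define D where "D = (1 + 4 * r1) * exp (9 * Q / (1 + 4 * r1))"
  have D: "0 < D" using r by (simp add: D_def)
  have qn: "(\<lambda>t. \<bar>q t\<bar>) integrable_on UNIV" "(\<lambda>t. \<bar>q t\<bar>) integrable_on {0..\<gamma>}"
    using q qa[of 0 \<gamma>] by (auto simp: absolutely_integrable_on_def)
  have M: "integral {0..\<gamma>} (\<lambda>t. \<bar>q t\<bar>) \<le> Q"
    using integral_subset_le[OF _ qn(2,1)] Q by auto
  have bound: "cmod (w z) \<le> D * exp (2 * \<gamma> * max 0 (- Im (z - 1/2)))"
    if "(1 + 4 * r1) / 9 + 1/2 \<le> cmod (z - 1/2)" "cmod (z - 1/2) \<le> 2 * r1" for z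
    using jost_annulus_bounds(3)[OF FG(5) qa \<gamma> FG(3,4) M _ that] r by (simp add: w_def D_def mult.assoc)
  obtain n where n: "zero_count r w = ereal n" "n * ln 2 \<le> ln D + 4 * r1 * \<gamma> / pi - ln (cmod (w (1/2)))"
    by (rule zero_count_le_two_discs_at_half[OF r hol _ D bound]) (use w1 in auto)
  have "ln D = ln (1 + 4 * r1) + 9 * Q / (1 + 4 * r1)" using r by (simp add: D_def ln_mult)
  moreover have "0 \<le> ln (cmod (w (1/2)))" using w1 by simp
  ultimately have "n * ln 2 \<le> 4 * r1 * \<gamma> / pi + ln (1 + 4 * r1) + 9 * Q / (1 + 4 * r1)"
    using n(2) by linarith
  then have "n \<le> 1 / ln 2 * (4 * r1 * \<gamma> / pi + ln (1 + 4 * r1) + 9 * Q / (1 + 4 * r1))"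
    by (simp add: pos_le_divide_eq)
  then show ?thesis by (simp add: W n)
qed

text \<open>Neither function is individually bounded below at \<open>1/2\<close>, but the flux bounds their product, so
  the two instances of Jensen's inequality are added. Of the two majorants only that of the derivative
  carries a factor \<open>2 r1 + 1/2\<close>, and this together with the loss \<open>ln 2\<close> at the centre makes up
  \<open>ln (1 + 4 r1)\<close>.\<close>

lemma half_line_zero_count_bound:
  fixes r r1 \<gamma> M :: real and q :: "real \<Rightarrow> real"
  assumes r: "0 < r" "r1 = r + 1/2" and q: "q absolutely_integrable_on {0..}" and \<gamma>: "0 \<le> \<gamma>"
    and supp: "ess_support {0..} q \<subseteq> {..\<gamma>}" and M0: "integral {0..} (\<lambda>t. \<bar>q t\<bar>) \<le> M"
  shows "(zero_count r (jost_plus {0..} q 0) + zero_count r (jost_plus_deriv {0..} q 0)) / 2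
     \<le> ereal (1 / ln 2 * (4 * r1 * \<gamma> / pi + ln (1 + 4 * r1) + 9 * M / (1 + 4 * r1)))"
proof -
  define q0 where "q0 t = (if t \<in> {0..} then q t else 0)" for t
  have q0: "q0 absolutely_integrable_on UNIV"
    using q absolutely_integrable_restrict_UNIV[of "{0..}" q] by (simp add: q0_def[abs_def])
  have q0a: "q0 absolutely_integrable_on {a..c}" for a c
    using q0 by (rule absolutely_integrable_on_subinterval) auto
  have qa: "q absolutely_integrable_on {a..c}" if "a \<in> {0..}" for a c
    using q by (rule absolutely_integrable_on_subinterval) (use that in auto)
  have N: "negligible {t. \<gamma> < t \<and> q0 t \<noteq> 0}"
    by (rule negligible_subset[OF negligible_off_ess_support[of "{0..}" q]]) (use supp in \<open>auto simp: q0_def split: if_splits\<close>)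
  obtain F G :: "complex \<Rightarrow> real \<Rightarrow> complex" where FG:
    "\<And>x. (\<lambda>k. F k x) holomorphic_on UNIV" "\<And>x. (\<lambda>k. G k x) holomorphic_on UNIV"
    "\<And>k x. \<gamma> \<le> x \<Longrightarrow> F k x = exp (\<i> * k * x)" "\<And>k x. \<gamma> \<le> x \<Longrightarrow> G k x = \<i> * k * exp (\<i> * k * x)"
    "\<And>a c k. solves_on a c q0 k (F k) (G k)"
    by (rule jost_family_exists[OF q0a N]) blast
  have s: "solves_on a c q k (F k) (G k)" if "a \<in> {0..}" for a c k
    by (rule solves_on_spike[OF FG(5) negligible_empty]) (use that in \<open>auto simp: q0_def\<close>)
  have P: "jost_plus {0..} q 0 = (\<lambda>k. F k 0)" "jost_plus_deriv {0..} q 0 = (\<lambda>k. G k 0)"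
    by (rule ext, rule jost_plus_eq[OF _ qa FG(1,3) s]; simp)+
  have flux: "Im (cnj (F (1/2) 0) * G (1/2) 0) = 1/2"
    using solves_on_flux[of \<gamma> q0 "1/2" "F (1/2)" "G (1/2)"] FG(3)[of \<gamma> "1/2"] FG(4)[of \<gamma> "1/2"] FG(5) \<gamma> by simp
  have prod: "1/2 \<le> cmod (F (1/2) 0) * cmod (G (1/2) 0)" by (rule flux_lower_bounds(1)[OF flux]) simp
  then have nz: "F (1/2) 0 \<noteq> 0" "G (1/2) 0 \<noteq> 0" by auto
  define e where "e = exp (9 * M / (1 + 4 * r1))"
  have "(\<lambda>t. \<bar>q t\<bar>) integrable_on {0..}" "(\<lambda>t. \<bar>q t\<bar>) integrable_on {0..\<gamma>}"
    using q qa[of 0 \<gamma>] by (auto simp: absolutely_integrable_on_def)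
  then have M: "integral {0..\<gamma>} (\<lambda>t. \<bar>q t\<bar>) \<le> M"
    using integral_subset_le[of "{0..\<gamma>}" "{0..}" "\<lambda>t. \<bar>q t\<bar>"] M0 by auto
  have bd: "cmod (F z 0) \<le> e * exp (2 * \<gamma> * max 0 (- Im (z - 1/2)))"
      "cmod (G z 0) \<le> ((2 * r1 + 1/2) * e) * exp (2 * \<gamma> * max 0 (- Im (z - 1/2)))"
    if "(1 + 4 * r1) / 9 + 1/2 \<le> cmod (z - 1/2)" "cmod (z - 1/2) \<le> 2 * r1" for z
    using jost_annulus_bounds(1,2)[OF s qa \<gamma> FG(3,4) M _ that] r by (simp_all add: e_def mult.assoc)
  obtain n1 where n1: "zero_count r (\<lambda>k. F k 0) = ereal n1"
    "n1 * ln 2 \<le> ln e + 4 * r1 * \<gamma> / pi - ln (cmod (F (1/2) 0))"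
    by (rule zero_count_le_two_discs_at_half[OF r FG(1)[of 0] nz(1) _ bd(1)]) (simp_all add: e_def)
  obtain n2 where n2: "zero_count r (\<lambda>k. G k 0) = ereal n2"
    "n2 * ln 2 \<le> ln ((2 * r1 + 1/2) * e) + 4 * r1 * \<gamma> / pi - ln (cmod (G (1/2) 0))"
    by (rule zero_count_le_two_discs_at_half[OF r FG(2)[of 0] nz(2) _ bd(2)]) (use r in \<open>simp_all add: e_def\<close>)
  have le: "ln e = 9 * M / (1 + 4 * r1)" by (simp add: e_def)
  have "ln ((2 * r1 + 1/2) * e) = ln (2 * r1 + 1/2) + ln e"
    using r by (intro ln_mult_pos) (auto simp: e_def)
  moreover have "ln (1 + 4 * r1) = ln 2 + ln (2 * r1 + 1/2)"
    using r by (subst ln_mult_pos[symmetric]) (auto simp: algebra_simps)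
  moreover have "- ln 2 \<le> ln (cmod (F (1/2) 0)) + ln (cmod (G (1/2) 0))"
  proof -
    have "- ln 2 = ln (1/2 :: real)" by (simp add: ln_div)
    also have "\<dots> \<le> ln (cmod (F (1/2) 0) * cmod (G (1/2) 0))" using prod by (subst ln_le_cancel_iff) auto
    also have "\<dots> = ln (cmod (F (1/2) 0)) + ln (cmod (G (1/2) 0))" using nz by (intro ln_mult_pos) auto
    finally show ?thesis .
  qed
  moreover have "0 \<le> ln (1 + 4 * r1)" using r by simp
  moreover define X Y where "X = 4 * r1 * \<gamma> / pi" and "Y = 9 * M / (1 + 4 * r1)"
  ultimately have "n1 * ln 2 + n2 * ln 2 \<le> 2 * (X + ln (1 + 4 * r1) + Y)"
    using n1(2) n2(2) unfolding le X_def[symmetric] Y_def[symmetric] by argo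
  then have "(n1 + n2) / 2 * ln 2 \<le> X + ln (1 + 4 * r1) + Y" by (simp add: algebra_simps)
  then have "(n1 + n2) / 2 \<le> 1 / ln 2 * (X + ln (1 + 4 * r1) + Y)"
    by (simp only: mult_1_left times_divide_eq_left pos_le_divide_eq[OF ln_gt_zero, of 2, simplified])
  moreover have "(ereal n1 + ereal n2) / 2 = ereal ((n1 + n2) / 2)"
  proof -
    have "(2 :: ereal) = ereal 2" by simp
    then show ?thesis by (metis ereal_divide plus_ereal.simps(1) zero_neq_numeral)
  qed
  ultimately show ?thesis by (simp only: P n1(1) n2(1) ereal_less_eq X_def Y_def)
qed

theorem theorem1p1:
  fixes r r1 :: real
  assumes "r > 0" and "r1 = r + 1/2"
  shows
    "(\<forall>(q :: real \<Rightarrow> real) (\<gamma> :: real) Q.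
        q absolutely_integrable_on UNIV \<and>
        compact (ess_support UNIV q) \<and>
        0 \<le> \<gamma> \<and>
        ess_support UNIV q \<subseteq> {0..\<gamma>} \<and>
        (\<forall>J. is_interval J \<and> J \<subset> {0..\<gamma>} \<longrightarrow> \<not> ess_support UNIV q \<subseteq> J) \<and>
        Q = max (integral UNIV (\<lambda>t. \<bar>q t\<bar>)) (integral UNIV (\<lambda>t. \<bar>t * q t\<bar>))
        \<longrightarrow>
        (\<forall>x. zero_count r (jost_wronskian q x)
           \<le> ereal (1 / ln 2 * (4 * r1 * \<gamma> / pi + ln (1 + 4 * r1) + 9 * Q / (1 + 4 * r1)))))
     \<and>
     (\<forall>(q :: real \<Rightarrow> real) (\<gamma> :: real).
        q absolutely_integrable_on {0..} \<and>
        compact (ess_support {0..} q) \<and>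
        \<comment> \<open>supremum taken in \<open>[0, \<infinity>)\<close>, so that \<open>\<gamma> = 0\<close> for \<open>q = 0\<close>\<close>
        \<gamma> = Sup (insert 0 (ess_support {0..} q))
        \<longrightarrow>
        (zero_count r (jost_plus {0..} q 0) + zero_count r (jost_plus_deriv {0..} q 0)) / 2
          \<le> ereal (1 / ln 2 * (4 * r1 * \<gamma> / pi + ln (1 + 4 * r1)
                     + 9 * integral {0..} (\<lambda>t. \<bar>q t\<bar>) * max 1 \<gamma> / (1 + 4 * r1))))"
proof (intro conjI allI impI)
  fix q :: "real \<Rightarrow> real" and \<gamma> Q x :: real
  assume "q absolutely_integrable_on UNIV \<and>
        compact (ess_support UNIV q) \<and>
        0 \<le> \<gamma> \<and>
        ess_support UNIV q \<subseteq> {0..\<gamma>} \<and>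
        (\<forall>J. is_interval J \<and> J \<subset> {0..\<gamma>} \<longrightarrow> \<not> ess_support UNIV q \<subseteq> J) \<and>
        Q = max (integral UNIV (\<lambda>t. \<bar>q t\<bar>)) (integral UNIV (\<lambda>t. \<bar>t * q t\<bar>))"
  then show "zero_count r (jost_wronskian q x)
      \<le> ereal (1 / ln 2 * (4 * r1 * \<gamma> / pi + ln (1 + 4 * r1) + 9 * Q / (1 + 4 * r1)))"
    by (intro wronskian_zero_count_bound assms) auto
next
  fix q :: "real \<Rightarrow> real" and \<gamma> :: real
  assume *: "q absolutely_integrable_on {0..} \<and> compact (ess_support {0..} q) \<and>
        \<gamma> = Sup (insert 0 (ess_support {0..} q))"
  let ?N = "integral {0..} (\<lambda>t. \<bar>q t\<bar>)"
  have bdd: "bdd_above (insert 0 (ess_support {0..} q))"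
  proof -
    have "bdd_above (ess_support {0..} q)"
      using * by (intro bounded_imp_bdd_above compact_imp_bounded) auto
    then show ?thesis by simp
  qed
  have \<gamma>: "0 \<le> \<gamma>" "ess_support {0..} q \<subseteq> {..\<gamma>}"
    using * cSup_upper[OF _ bdd] by auto
  have "0 \<le> ?N" using * by (intro integral_nonneg) (auto simp: absolutely_integrable_on_def)
  then have "?N \<le> ?N * max 1 \<gamma>" by (simp add: mult_le_cancel_left1)
  then show "(zero_count r (jost_plus {0..} q 0) + zero_count r (jost_plus_deriv {0..} q 0)) / 2
          \<le> ereal (1 / ln 2 * (4 * r1 * \<gamma> / pi + ln (1 + 4 * r1)
                     + 9 * ?N * max 1 \<gamma> / (1 + 4 * r1)))"
    using half_line_zero_count_bound[OF assms conjunct1[OF *] \<gamma>, of "?N * max 1 \<gamma>"]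
    by (simp only: mult.assoc)
qed

end
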